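(* Let $U\subseteq M$ be open and let $f:U\to\mathbb C$ be an eigenfunction of the Laplace-Beltrami operator ($-\Delta f=\lambda f$ for some $\lambda\in\mathbb C$). Then, as a vector space, $$\Pi(T(E))f=\mathbb Cf,$$ i.e. the action of every parallel tensor on $f$ is a scalar multiple of $f$.
   Context: $M$ is a two-dimensional, connected, complete, orientable Riemannian manifold of constant sectional curvature $K\neq0$; $E=\mathbb C\otimes_{\mathbb R}TM$ with the complex-linearly extended Levi-Civita connection $\nabla$. $\Pi(T(E))=\bigoplus_{k\ge0}\Pi(E^{\otimes k})$ is the algebra (under $\otimes$) of global parallel sections of the tensor powers of $E$. A parallel tensor $X\in\Pi(E^{\otimes k})$ acts on smooth functions $g\in C^\infty(U)$ (complex valued) by $g\mapsto(\nabla^kg)(X)$, where $(\nabla^kg)(Z_1,\dots,Z_k)=(\nabla_{Z_1}(\nabla^{k-1}g))(Z_2,\dots,Z_k)$; $\Pi(T(E))f$ is the set of all images of $f$. *)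

theory Defs
  imports "HOL-Analysis.Analysis"
begin

text \<open>
  A surface is a type (Hausdorff, second countable) together with a smooth atlas \<open>A\<close> on it.
  A chart is a pair of its domain and its coordinate map.  Tensor fields are given classically,
  by their components in each chart of the atlas, subject to the transformation law.
\<close>

subsection \<open>Smooth functions on open subsets of the plane\<close>

definition partial :: "2 \<Rightarrow> (real^2 \<Rightarrow> 'b::real_normed_vector) \<Rightarrow> real^2 \<Rightarrow> 'b"
  where "partial i h x = frechet_derivative h (at x) (axis i 1)"

text \<open>To be used for open \<open>S\<close> only.\<close>

primrec Ck_on :: "nat \<Rightarrow> (real^2) set \<Rightarrow> (real^2 \<Rightarrow> 'b::real_normed_vector) \<Rightarrow> bool"
  where
    "Ck_on 0 S h \<longleftrightarrow> continuous_on S h"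
  | "Ck_on (Suc k) S h \<longleftrightarrow>
      (\<forall>x\<in>S. h differentiable (at x)) \<and> (\<forall>i. Ck_on k S (partial i h))"

definition Cinf_on :: "(real^2) set \<Rightarrow> (real^2 \<Rightarrow> 'b::real_normed_vector) \<Rightarrow> bool"
  where "Cinf_on S h \<longleftrightarrow> (\<forall>k. Ck_on k S h)"


subsection \<open>Smooth surfaces\<close>

type_synonym 'a chart = "'a set \<times> ('a \<Rightarrow> real^2)"

abbreviation cdom :: "'a chart \<Rightarrow> 'a set"
  where "cdom \<equiv> fst"

abbreviation coord :: "'a chart \<Rightarrow> 'a \<Rightarrow> real^2"
  where "coord \<equiv> snd"

definition coord_inv :: "'a chart \<Rightarrow> real^2 \<Rightarrow> 'a"
  where "coord_inv c = inv_into (cdom c) (coord c)"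

definition is_chart :: "'a::topological_space chart \<Rightarrow> bool"
  where "is_chart c \<longleftrightarrow> open (cdom c) \<and> open (coord c ` cdom c) \<and>
    homeomorphism (cdom c) (coord c ` cdom c) (coord c) (coord_inv c)"

definition smooth_atlas :: "'a::topological_space chart set \<Rightarrow> bool"
  where "smooth_atlas A \<longleftrightarrow> (\<forall>c\<in>A. is_chart c) \<and> (\<Union>c\<in>A. cdom c) = UNIV \<and>
    (\<forall>c\<in>A. \<forall>d\<in>A. Cinf_on (coord c ` (cdom c \<inter> cdom d)) (coord d \<circ> coord_inv c))"

definition smooth_fun_on ::
    "'a::topological_space chart set \<Rightarrow> 'a set \<Rightarrow> ('a \<Rightarrow> 'b::real_normed_vector) \<Rightarrow> bool"
  where "smooth_fun_on A W h \<longleftrightarrow>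
    (\<forall>c\<in>A. Cinf_on (coord c ` (W \<inter> cdom c)) (h \<circ> coord_inv c))"

text \<open>The coordinate vector field \<open>\<partial>/\<partial>x\<^sup>i\<close> of the chart \<open>c\<close>, applied to \<open>h\<close>, at the point \<open>p\<close>.\<close>

definition pd :: "'a chart \<Rightarrow> 2 \<Rightarrow> ('a \<Rightarrow> 'b::real_normed_vector) \<Rightarrow> 'a \<Rightarrow> 'b"
  where "pd c i h p = partial i (h \<circ> coord_inv c) (coord c p)"

text \<open>The entry in row \<open>a\<close> and column \<open>b\<close> is \<open>\<partial>y\<^sup>a/\<partial>x\<^sup>b\<close>, for coordinates \<open>x\<close> of \<open>c\<close> and \<open>y\<close> of \<open>d\<close>.\<close>

definition jac :: "'a chart \<Rightarrow> 'a chart \<Rightarrow> 'a \<Rightarrow> real^2^2"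
  where "jac c d p = (\<chi> a b. pd c b (\<lambda>q. coord d q $ a) p)"

definition orientable :: "'a::topological_space chart set \<Rightarrow> bool"
  where "orientable A \<longleftrightarrow> (\<exists>B. smooth_atlas B \<and> smooth_atlas (A \<union> B) \<and>
    (\<forall>c\<in>B. \<forall>d\<in>B. \<forall>p\<in>cdom c \<inter> cdom d. det (jac c d p) > 0))"


subsection \<open>Riemannian metrics\<close>

type_synonym 'a metric = "'a chart \<Rightarrow> 'a \<Rightarrow> real^2^2"

definition riemannian_metric :: "'a::topological_space chart set \<Rightarrow> 'a metric \<Rightarrow> bool"
  where "riemannian_metric A g \<longleftrightarrow>
    (\<forall>c\<in>A. smooth_fun_on A (cdom c) (g c)) \<and>
    (\<forall>c\<in>A. \<forall>p\<in>cdom c. transpose (g c p) = g c p \<and> (\<forall>v. v \<noteq> 0 \<longrightarrow> v \<bullet> (g c p *v v) > 0)) \<and>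
    (\<forall>c\<in>A. \<forall>d\<in>A. \<forall>p\<in>cdom c \<inter> cdom d.
       g c p = transpose (jac c d p) ** g d p ** jac c d p)"

definition ginv :: "'a metric \<Rightarrow> 'a chart \<Rightarrow> 'a \<Rightarrow> real^2^2"
  where "ginv g c p = matrix_inv (g c p)"

text \<open>The Levi-Civita connection: \<open>\<nabla>\<close> of \<open>\<partial>\<^sub>j\<close> in direction \<open>\<partial>\<^sub>i\<close> is
  \<open>\<Sum>l. christoffel g c l i j \<partial>\<^sub>l\<close>.\<close>

definition christoffel :: "'a metric \<Rightarrow> 'a chart \<Rightarrow> 2 \<Rightarrow> 2 \<Rightarrow> 2 \<Rightarrow> 'a \<Rightarrow> real"
  where "christoffel g c l i j p = (1/2) * (\<Sum>m\<in>UNIV. ginv g c p $ l $ m *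
    (pd c i (\<lambda>q. g c q $ j $ m) p + pd c j (\<lambda>q. g c q $ i $ m) p - pd c m (\<lambda>q. g c q $ i $ j) p))"

text \<open>\<open>R(\<partial>\<^sub>i,\<partial>\<^sub>j)\<partial>\<^sub>k = \<Sum>l. riemann g c l k i j \<partial>\<^sub>l\<close>, where
  \<open>R(X,Y) = [\<nabla>\<^sub>X,\<nabla>\<^sub>Y] - \<nabla>\<close> in direction \<open>[X,Y]\<close>.\<close>

definition riemann :: "'a metric \<Rightarrow> 'a chart \<Rightarrow> 2 \<Rightarrow> 2 \<Rightarrow> 2 \<Rightarrow> 2 \<Rightarrow> 'a \<Rightarrow> real"
  where "riemann g c l k i j p =
    pd c i (christoffel g c l j k) p - pd c j (christoffel g c l i k) p +
    (\<Sum>m\<in>UNIV. christoffel g c l i m p * christoffel g c m j k p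
              - christoffel g c l j m p * christoffel g c m i k p)"

text \<open>\<open>\<langle>R(u,v)v, u\<rangle> / (\<langle>u,u\<rangle>\<langle>v,v\<rangle> - \<langle>u,v\<rangle>\<^sup>2)\<close>, for \<open>u\<close> and \<open>v\<close> given by their components in \<open>c\<close>.\<close>

definition sectional_curvature ::
    "'a metric \<Rightarrow> 'a chart \<Rightarrow> 'a \<Rightarrow> real^2 \<Rightarrow> real^2 \<Rightarrow> real"
  where "sectional_curvature g c p u v =
    (let Ruvv = (\<chi> l. \<Sum>i\<in>UNIV. \<Sum>j\<in>UNIV. \<Sum>k\<in>UNIV. riemann g c l k i j p * u$i * v$j * v$k);
         ip = (\<lambda>x y. x \<bullet> (g c p *v y))
     in ip Ruvv u / (ip u u * ip v v - (ip u v)\<^sup>2))"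

definition constant_sectional_curvature ::
    "'a chart set \<Rightarrow> 'a metric \<Rightarrow> real \<Rightarrow> bool"
  where "constant_sectional_curvature A g K \<longleftrightarrow>
    (\<forall>c\<in>A. \<forall>p\<in>cdom c. \<forall>u v. u \<noteq> v \<and> independent {u, v} \<longrightarrow>
       sectional_curvature g c p u v = K)"

definition geodesic ::
    "'a::topological_space chart set \<Rightarrow> 'a metric \<Rightarrow> (real \<Rightarrow> 'a) \<Rightarrow> bool"
  where "geodesic A g \<gamma> \<longleftrightarrow> continuous_on UNIV \<gamma> \<and>
    (\<forall>c\<in>A. \<exists>w :: real \<Rightarrow> real^2. \<forall>t. \<gamma> t \<in> cdom c \<longrightarrow>
       ((coord c \<circ> \<gamma>) has_vector_derivative w t) (at t) \<and>
       (w has_vector_derivative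
         (\<chi> l. - (\<Sum>i\<in>UNIV. \<Sum>j\<in>UNIV. christoffel g c l i j (\<gamma> t) * w t $ i * w t $ j))) (at t))"

definition geodesically_complete ::
    "'a::topological_space chart set \<Rightarrow> 'a metric \<Rightarrow> bool"
  where "geodesically_complete A g \<longleftrightarrow>
    (\<forall>c\<in>A. \<forall>p\<in>cdom c. \<forall>v. \<exists>\<gamma>. geodesic A g \<gamma> \<and> \<gamma> 0 = p \<and>
       ((coord c \<circ> \<gamma>) has_vector_derivative v) (at 0))"


subsection \<open>The Laplace--Beltrami operator in a chart, as divergence of the gradient\<close>

definition grad :: "'a metric \<Rightarrow> 'a chart \<Rightarrow> ('a \<Rightarrow> complex) \<Rightarrow> 2 \<Rightarrow> 'a \<Rightarrow> complex"
  where "grad g c h i p = (\<Sum>j\<in>UNIV. of_real (ginv g c p $ i $ j) * pd c j h p)"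

text \<open>The trace of \<open>\<nabla>V\<close>, for a complex vector field with components \<open>V\<close>.\<close>

definition divergence :: "'a metric \<Rightarrow> 'a chart \<Rightarrow> (2 \<Rightarrow> 'a \<Rightarrow> complex) \<Rightarrow> 'a \<Rightarrow> complex"
  where "divergence g c V p = (\<Sum>i\<in>UNIV. pd c i (V i) p +
    (\<Sum>j\<in>UNIV. of_real (christoffel g c i i j p) * V j p))"

definition laplacian :: "'a metric \<Rightarrow> 'a chart \<Rightarrow> ('a \<Rightarrow> complex) \<Rightarrow> 'a \<Rightarrow> complex"
  where "laplacian g c h = divergence g c (grad g c h)"


subsection \<open>Parallel sections of the tensor powers of the complexified tangent bundle\<close>

text \<open>\<open>X c p [j\<^sub>1, \<dots>, j\<^sub>k]\<close> is the coefficient of \<open>\<partial>\<^bsub>j\<^sub>1\<^esub> \<otimes> \<dots> \<otimes> \<partial>\<^bsub>j\<^sub>k\<^esub>\<close> in the chart \<open>c\<close> at the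
  point \<open>p\<close>.  Meaningless components are required to be zero, so that equality of functions
  is equality of sections.\<close>

type_synonym 'a tensor = "'a chart \<Rightarrow> 'a \<Rightarrow> 2 list \<Rightarrow> complex"

definition tensor_section :: "'a::topological_space chart set \<Rightarrow> nat \<Rightarrow> 'a tensor \<Rightarrow> bool"
  where "tensor_section A k X \<longleftrightarrow>
    (\<forall>c p J. X c p J \<noteq> 0 \<longrightarrow> c \<in> A \<and> p \<in> cdom c \<and> length J = k) \<and>
    (\<forall>c\<in>A. \<forall>J. length J = k \<longrightarrow> smooth_fun_on A (cdom c) (\<lambda>p. X c p J)) \<and>
    (\<forall>c\<in>A. \<forall>d\<in>A. \<forall>p\<in>cdom c \<inter> cdom d. \<forall>J. length J = k \<longrightarrow>
       X d p J = (\<Sum>I | length I = k.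
         (\<Prod>r<k. of_real (jac c d p $ (J!r) $ (I!r))) * X c p I))"

text \<open>The \<open>J\<close>-component of the covariant derivative of \<open>X\<close> in direction \<open>\<partial>\<^sub>i\<close>.\<close>

definition cov_deriv_tensor ::
    "'a metric \<Rightarrow> 'a chart \<Rightarrow> 2 \<Rightarrow> 'a tensor \<Rightarrow> 2 list \<Rightarrow> 'a \<Rightarrow> complex"
  where "cov_deriv_tensor g c i X J p = pd c i (\<lambda>q. X c q J) p +
    (\<Sum>r<length J. \<Sum>m\<in>UNIV. of_real (christoffel g c (J!r) i m p) * X c p (J[r := m]))"

definition parallel_tensors ::
    "'a::topological_space chart set \<Rightarrow> 'a metric \<Rightarrow> nat \<Rightarrow> 'a tensor set"
  where "parallel_tensors A g k = {X. tensor_section A k X \<and>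
    (\<forall>c\<in>A. \<forall>p\<in>cdom c. \<forall>i J. length J = k \<longrightarrow> cov_deriv_tensor g c i X J p = 0)}"

text \<open>The direct sum over all degrees: sequences with only finitely many nonzero terms.\<close>

definition parallel_algebra ::
    "'a::topological_space chart set \<Rightarrow> 'a metric \<Rightarrow> (nat \<Rightarrow> 'a tensor) set"
  where "parallel_algebra A g = {X. (\<forall>k. X k \<in> parallel_tensors A g k) \<and>
    finite {k. X k \<noteq> (\<lambda>c p J. 0)}}"


subsection \<open>The action on functions\<close>

text \<open>The covariant derivative of a covariant tensor with components \<open>T\<close> in the chart \<open>c\<close>;
  the direction of differentiation becomes the first slot.\<close>

fun cov_deriv ::
    "'a metric \<Rightarrow> 'a chart \<Rightarrow> (2 list \<Rightarrow> 'a \<Rightarrow> complex) \<Rightarrow> 2 list \<Rightarrow> 'a \<Rightarrow> complex"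
  where
    "cov_deriv g c T [] p = 0"
  | "cov_deriv g c T (i # I) p = pd c i (T I) p -
      (\<Sum>r<length I. \<Sum>m\<in>UNIV. of_real (christoffel g c m i (I!r) p) * T (I[r := m]) p)"

text \<open>The components of \<open>\<nabla>\<^sup>k h\<close>; only index lists of length \<open>k\<close> are meaningful.\<close>

primrec nabla_pow ::
    "'a metric \<Rightarrow> 'a chart \<Rightarrow> nat \<Rightarrow> ('a \<Rightarrow> complex) \<Rightarrow> 2 list \<Rightarrow> 'a \<Rightarrow> complex"
  where
    "nabla_pow g c 0 h = (\<lambda>I. h)"
  | "nabla_pow g c (Suc k) h = cov_deriv g c (nabla_pow g c k h)"

text \<open>\<open>(\<nabla>\<^sup>k h)(X)\<close> for a section \<open>X\<close> of degree \<open>k\<close>, computed in the chart \<open>c\<close>.\<close>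

definition chart_act ::
    "'a metric \<Rightarrow> 'a chart \<Rightarrow> nat \<Rightarrow> 'a tensor \<Rightarrow> ('a \<Rightarrow> complex) \<Rightarrow> 'a \<Rightarrow> complex"
  where "chart_act g c k X h p = (\<Sum>I | length I = k. nabla_pow g c k h I p * X c p I)"

text \<open>As a full contraction of tensors, \<open>chart_act\<close> has the same value at \<open>p\<close> in all charts
  around \<open>p\<close>, so any of them may be chosen.\<close>

definition chart_at :: "'a chart set \<Rightarrow> 'a \<Rightarrow> 'a chart"
  where "chart_at A p = (SOME c. c \<in> A \<and> p \<in> cdom c)"

definition act ::
    "'a chart set \<Rightarrow> 'a metric \<Rightarrow> (nat \<Rightarrow> 'a tensor) \<Rightarrow> ('a \<Rightarrow> complex) \<Rightarrow> 'a \<Rightarrow> complex"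
  where "act A g X h p =
    (\<Sum>k | X k \<noteq> (\<lambda>c p J. 0). chart_act g (chart_at A p) k (X k) h p)"

text \<open>The set of all images of \<open>h\<close>; functions on \<open>U\<close> are represented as
  functions restricted to \<open>U\<close>.\<close>

definition parallel_images ::
    "'a::topological_space chart set \<Rightarrow> 'a metric \<Rightarrow> 'a set \<Rightarrow> ('a \<Rightarrow> complex) \<Rightarrow> ('a \<Rightarrow> complex) set"
  where "parallel_images A g U h = {restrict (act A g X h) U | X. X \<in> parallel_algebra A g}"

end

theory Submission
  imports Defs
begin

text \<open>
  On a chart there is a complex frame \<open>Z\<^sub>1, Z\<^sub>2\<close> of null vectors with \<open>g(Z\<^sub>1, Z\<^sub>2) = 1\<close>, and
  \<open>\<nabla> Z\<^sub>1 = \<alpha> Z\<^sub>1\<close>, \<open>\<nabla> Z\<^sub>2 = - \<alpha> Z\<^sub>2\<close> for a complex 1-form \<open>\<alpha>\<close> with \<open>d\<alpha>(Z\<^sub>1, Z\<^sub>2) = K\<close>.  Let the weight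
  \<open>s\<close> of a word in \<open>{1, 2}\<close> be the number of ones minus the number of twos.  The frame component \<open>X\<^sub>w\<close>
  of a parallel tensor satisfies \<open>dX\<^sub>w = - s(w) \<alpha> X\<^sub>w\<close>; hence it is locally constant if \<open>s(w) = 0\<close>, and
  since \<open>d\<alpha> \<noteq> 0\<close> it vanishes otherwise.

  The frame components \<open>f\<^sub>w\<close> of the iterated covariant derivatives of \<open>f\<close> satisfy the commutation rule
  \<open>f\<^bsub>12w\<^esub> - f\<^bsub>21w\<^esub> = - s(w) K f\<^sub>w\<close>, and \<open>f\<^bsub>12\<^esub> + f\<^bsub>21\<^esub> = \<Delta>f = - \<lambda> f\<close>.  As in a highest weight module, it
  follows that \<open>f\<^sub>w\<close> is a multiple, by a factor depending only on \<open>w\<close>, \<open>\<lambda>\<close> and \<open>K\<close>, of the component at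
  the word of the same weight in only one letter, which is \<open>f\<close> itself if \<open>s(w) = 0\<close>.  So \<open>X\<close> acts
  on \<open>f\<close> as a locally constant function \<open>\<mu>\<close>.
  As the multiples are the same for \<open>w\<close> and the word with \<open>1\<close> and \<open>2\<close> exchanged, \<open>\<mu>\<close> does not
  depend on the chart, and it is constant because \<open>M\<close> is connected.
\<close>

subsection \<open>Calculus of \<open>C\<^sup>k\<close> functions on the plane\<close>

lemma partial_cong:
  assumes "open S" "x \<in> S" "\<And>y. y \<in> S \<Longrightarrow> h y = h' y"
  shows "partial i h x = partial i h' x"
proof -
  have "(h has_derivative D) (at x) \<longleftrightarrow> (h' has_derivative D) (at x)" for D
    using assms has_derivative_transform_within_open[of h D x UNIV S h']
      has_derivative_transform_within_open[of h' D x UNIV S h] by metis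
  then show ?thesis
    by (simp add: partial_def frechet_derivative_def)
qed

lemma partial_eq: "(h has_derivative D) (at x) \<Longrightarrow> partial i h x = D (axis i 1)"
  by (simp add: partial_def frechet_derivative_at[symmetric])

lemma Ck_on_cong:
  assumes "open S" "\<And>y. y \<in> S \<Longrightarrow> h y = h' y"
  shows "Ck_on k S h \<longleftrightarrow> Ck_on k S h'"
  using assms(2)
proof (induction k arbitrary: h h')
  case 0
  then show ?case by (simp cong: continuous_on_cong)
next
  case (Suc k)
  have "h differentiable (at x) \<longleftrightarrow> h' differentiable (at x)" if "x \<in> S" for x
    using that assms(1) Suc.prems
      has_derivative_transform_within_open[of h _ x UNIV S h']
      has_derivative_transform_within_open[of h' _ x UNIV S h]
    unfolding differentiable_def by metis
  moreover have "Ck_on k S (partial i h) \<longleftrightarrow> Ck_on k S (partial i h')" for i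
    using partial_cong[OF assms(1)] Suc.prems by (intro Suc.IH) blast
  ultimately show ?case by simp
qed

lemma Ck_on_subset: "Ck_on k S h \<Longrightarrow> T \<subseteq> S \<Longrightarrow> Ck_on k T h"
  by (induction k arbitrary: h) (auto intro: continuous_on_subset)

lemma Ck_on_SucD: "Ck_on (Suc k) S h \<Longrightarrow> Ck_on k S h"
proof (induction k arbitrary: h)
  case 0
  then show ?case
    by (simp add: continuous_at_imp_continuous_on differentiable_imp_continuous_within)
next
  case (Suc k)
  show ?case
    using Suc.prems Suc.IH[of "partial _ h"] by simp
qed

text \<open>The induction step of the closure rules below: it suffices to exhibit some derivative
  and to know that its values on the axis vectors are \<open>Ck_on k\<close>. These values are then
  built from functions covered by the induction hypothesis.\<close>

lemma Ck_on_SucI: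
  assumes "open S" "\<And>x. x \<in> S \<Longrightarrow> (h has_derivative D x) (at x)"
    and "\<And>i. Ck_on k S (\<lambda>x. D x (axis i 1))"
  shows "Ck_on (Suc k) S h"
proof -
  have "Ck_on k S (partial i h)" for i
    using assms(3) partial_eq[OF assms(2)] Ck_on_cong[OF assms(1), of "partial i h"] by simp
  then show ?thesis
    using assms(2) by (auto simp: differentiable_def)
qed

lemma Ck_on_derivative:
  assumes "Ck_on (Suc k) S h" "x \<in> S"
  shows "(h has_derivative frechet_derivative h (at x)) (at x)"
  using assms by (simp add: frechet_derivative_works[symmetric])

lemma Ck_on_frechet: "Ck_on (Suc k) S h \<Longrightarrow> Ck_on k S (\<lambda>x. frechet_derivative h (at x) (axis i 1))"
  by (simp add: partial_def[abs_def])

lemma Ck_on_const: "open S \<Longrightarrow> Ck_on k S (\<lambda>x. c)"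
proof (induction k arbitrary: c)
  case (Suc k)
  then show ?case
    by (intro Ck_on_SucI[where D = "\<lambda>_ _. 0"]) auto
qed simp

lemma Ck_on_linear:
  assumes "bounded_linear L" "open S"
  shows "Ck_on k S h \<Longrightarrow> Ck_on k S (\<lambda>x. L (h x))"
proof (induction k arbitrary: h)
  case 0
  then show ?case
    using bounded_linear.continuous_on[OF assms(1)] by simp
next
  case (Suc k)
  show ?case
    by (rule Ck_on_SucI[OF assms(2)])
      (auto intro: bounded_linear.has_derivative[OF assms(1)] Ck_on_derivative[OF Suc.prems]
        Suc.IH Ck_on_frechet[OF Suc.prems])
qed

lemma Ck_on_add:
  assumes "open S"
  shows "Ck_on k S h \<Longrightarrow> Ck_on k S h' \<Longrightarrow> Ck_on k S (\<lambda>x. h x + h' x)"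
proof (induction k arbitrary: h h')
  case 0
  then show ?case by (simp add: continuous_on_add)
next
  case (Suc k)
  show ?case
    by (rule Ck_on_SucI[OF assms has_derivative_add])
      (auto intro!: Suc.IH Ck_on_derivative[OF Suc.prems(1)] Ck_on_derivative[OF Suc.prems(2)]
        Ck_on_frechet[OF Suc.prems(1)] Ck_on_frechet[OF Suc.prems(2)])
qed

lemma Ck_on_bilinear:
  assumes "bounded_bilinear B" "open S"
  shows "Ck_on k S h \<Longrightarrow> Ck_on k S h' \<Longrightarrow> Ck_on k S (\<lambda>x. B (h x) (h' x))"
proof (induction k arbitrary: h h')
  case 0
  then show ?case using bounded_bilinear.continuous_on[OF assms(1)] by simp
next
  case (Suc k)
  show ?case
    by (rule Ck_on_SucI[OF assms(2) bounded_bilinear.FDERIV[OF assms(1)]])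
      (auto intro!: Suc.IH Ck_on_add assms(2) Ck_on_derivative[OF Suc.prems(1)]
        Ck_on_derivative[OF Suc.prems(2)]
        Ck_on_SucD[OF Suc.prems(1)] Ck_on_SucD[OF Suc.prems(2)]
        Ck_on_frechet[OF Suc.prems(1)] Ck_on_frechet[OF Suc.prems(2)])
qed

text \<open>The derivative of 1/h is -(1/h) Dh (1/h), in which 1/h is needed only to order
  \<open>k\<close>. The same bootstrapping works for the square root, with derivative Dh / (2 sqrt
  h).\<close>

lemma Ck_on_inverse:
  fixes h :: "real^2 \<Rightarrow> 'b::real_normed_field"
  assumes "open S" "\<And>x. x \<in> S \<Longrightarrow> h x \<noteq> 0"
  shows "Ck_on k S h \<Longrightarrow> Ck_on k S (\<lambda>x. inverse (h x))"
proof (induction k)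
  case 0
  then show ?case using assms(2) by (auto intro: continuous_on_inverse)
next
  case (Suc k)
  note C = Suc.IH[OF Ck_on_SucD[OF Suc.prems]]
  show ?case
    by (rule Ck_on_SucI[OF assms(1) Deriv.has_derivative_inverse])
      (auto intro!: assms Ck_on_derivative[OF Suc.prems] C Ck_on_frechet[OF Suc.prems]
        Ck_on_bilinear[OF bounded_bilinear_mult]
        Ck_on_linear[OF bounded_linear_minus[OF bounded_linear_ident]])
qed

lemma Ck_on_sqrt:
  fixes h :: "real^2 \<Rightarrow> real"
  assumes "open S" "\<And>x. x \<in> S \<Longrightarrow> h x > 0"
  shows "Ck_on k S h \<Longrightarrow> Ck_on k S (\<lambda>x. sqrt (h x))"
proof (induction k)
  case 0
  then show ?case by (auto intro: continuous_on_real_sqrt)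
next
  case (Suc k)
  note C = Suc.IH[OF Ck_on_SucD[OF Suc.prems]]
  have "Ck_on k S (\<lambda>x. inverse (2 * sqrt (h x)))"
    using assms by (intro Ck_on_inverse Ck_on_bilinear[OF bounded_bilinear_mult] C Ck_on_const)
      (auto simp: less_imp_neq[symmetric])
  then have D: "Ck_on k S (\<lambda>x. frechet_derivative h (at x) (axis i 1) * inverse (2 * sqrt (h x)))" for i
    by (intro Ck_on_bilinear[OF bounded_bilinear_mult] assms(1) Ck_on_frechet[OF Suc.prems])
  show ?case
  proof (rule Ck_on_SucI[OF assms(1)])
    fix x assume x: "x \<in> S"
    have "((\<lambda>x. sqrt (h x)) has_derivative (*) (inverse (2 * sqrt (h x))) \<circ> frechet_derivative h (at x)) (at x)"
      unfolding comp_def[of sqrt h, symmetric]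
      using DERIV_real_sqrt[OF assms(2)[OF x]] 
      by (intro diff_chain_at Ck_on_derivative[OF Suc.prems x])
        (simp add: has_field_derivative_def field_simps)
    then show "((\<lambda>x. sqrt (h x)) has_derivative
        (\<lambda>v. frechet_derivative h (at x) v * inverse (2 * sqrt (h x)))) (at x)"
      by (simp add: comp_def mult.commute)
  qed (use D in simp)
qed

section \<open>Mean values and the symmetry of second derivatives\<close>

lemma partial_mean_value:
  fixes h :: "real^2 \<Rightarrow> real"
  assumes "t > 0" and "\<And>s. 0 \<le> s \<Longrightarrow> s \<le> t \<Longrightarrow> h differentiable (at (y + axis i s))"
  obtains s where "0 < s" "s < t" "h (y + axis i t) - h y = t * partial i h (y + axis i s)"
proof -
  have D: "((\<lambda>s. h (y + axis i s)) has_real_derivative partial i h (y + axis i s)) (at s)"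
    if "0 \<le> s" "s \<le> t" for s
  proof -
    let ?D = "frechet_derivative h (at (y + axis i s))"
    have D: "(h has_derivative ?D) (at (y + axis i s))"
      using assms(2)[OF that] frechet_derivative_works by blast
    have "(\<lambda>s. y + axis i s) = (\<lambda>s. y + s *\<^sub>R (axis i 1 :: real^2))"
      by (simp add: fun_eq_iff vec_eq_iff axis_def)
    then have "((\<lambda>s. y + axis i s) has_derivative (\<lambda>r. r *\<^sub>R (axis i 1 :: real^2))) (at s)"
      by (auto intro!: derivative_eq_intros)
    from diff_chain_at[OF this D]
    have "((\<lambda>s. h (y + axis i s)) has_derivative (\<lambda>r. ?D (r *\<^sub>R axis i 1))) (at s)"
      by (simp only: comp_def)
    moreover have "?D (r *\<^sub>R axis i 1) = partial i h (y + axis i s) * r" for r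
      unfolding partial_def linear_cmul[OF has_derivative_linear[OF D]] by simp
    ultimately show ?thesis
      by (simp add: has_field_derivative_def)
  qed
  have "\<exists>s. 0 < s \<and> s < t \<and> h (y + axis i t) - h (y + axis i 0) = (t - 0) * partial i h (y + axis i s)"
    using MVT2[OF assms(1) D] by auto
  moreover have "axis i 0 = (0 :: real^2)"
    by (simp add: vec_eq_iff axis_def)
  ultimately show ?thesis
    using that by auto
qed

text \<open>Two applications of the mean value theorem: in direction \<open>i\<close> to the
  increment \<open>?G\<close> of \<open>h\<close> in direction \<open>j\<close>, then in direction
  \<open>j\<close> to \<open>partial i h\<close>.\<close>

lemma second_difference_mean_value:
  fixes h :: "real^2 \<Rightarrow> real"
  assumes "t > 0" and "Ck_on 2 S h"
    and S: "\<And>s r. 0 \<le> s \<Longrightarrow> s \<le> t \<Longrightarrow> 0 \<le> r \<Longrightarrow> r \<le> t \<Longrightarrow> x + axis i s + axis j r \<in> S"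
  obtains s r where "0 < s" "s < t" "0 < r" "r < t"
    "h (x + axis i t + axis j t) - h (x + axis i t) - h (x + axis j t) + h x
      = t * t * partial j (partial i h) (x + axis i s + axis j r)"
proof -
  have d: "\<And>y. y \<in> S \<Longrightarrow> h differentiable (at y)"
      "\<And>y. y \<in> S \<Longrightarrow> partial i h differentiable (at y)"
    using assms(2) by (auto simp: numeral_2_eq_2)
  have z: "axis k 0 = (0 :: real^2)" for k
    by (simp add: vec_eq_iff axis_def)
  let ?G = "\<lambda>y. h (y + axis j t) - h y"
  have d1: "h differentiable (at (x + axis i s + axis j t))" "h differentiable (at (x + axis i s))"
    if "0 \<le> s" "s \<le> t" for s
    using d(1) S[OF that, of t] S[OF that, of 0] assms(1) by (auto simp: z)
  have G: "(?G has_derivative (\<lambda>v. frechet_derivative h (at (y + axis j t)) v - frechet_derivative h (at y) v)) (at y)"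
    if "h differentiable (at (y + axis j t))" "h differentiable (at y)" for y
  proof -
    have "((\<lambda>y. y + axis j t) has_derivative (\<lambda>v. v)) (at y)"
      by (auto intro!: derivative_eq_intros)
    from diff_chain_at[OF this] that show ?thesis
      by (intro has_derivative_diff) (auto simp: frechet_derivative_works comp_def)
  qed
  obtain s where s: "0 < s" "s < t" "?G (x + axis i t) - ?G x = t * partial i ?G (x + axis i s)"
  proof (rule partial_mean_value[OF assms(1), of ?G x i])
    show "?G differentiable (at (x + axis i s))" if "0 \<le> s" "s \<le> t" for s
      using G[OF d1[OF that]] by (auto simp: differentiable_def)
  qed
  have e: "partial i ?G (x + axis i s) = partial i h (x + axis i s + axis j t) - partial i h (x + axis i s)"
    using partial_eq[OF G[OF d1]] s by (simp add: partial_def)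
  obtain r where "0 < r" "r < t"
    "partial i h (x + axis i s + axis j t) - partial i h (x + axis i s)
      = t * partial j (partial i h) (x + axis i s + axis j r)"
    using d(2) S s by (blast intro: partial_mean_value[OF assms(1), of "partial i h" "x + axis i s" j] less_imp_le)
  with s e show ?thesis
    by (intro that[of s r]) (auto simp: algebra_simps)
qed

text \<open>The second difference is symmetric in \<open>i\<close> and \<open>j\<close>. Hence the
  two mixed derivatives agree at two points arbitrarily close to \<open>x\<close>, and by continuity
  at \<open>x\<close>.\<close>

lemma partial_commute_real:
  fixes h :: "real^2 \<Rightarrow> real"
  assumes "open S" "Ck_on 2 S h" "x \<in> S"
  shows "partial i (partial j h) x = partial j (partial i h) x"
proof -
  have c: "isCont (partial i (partial j h)) x" "isCont (partial j (partial i h)) x"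
    using assms by (auto simp: numeral_2_eq_2 continuous_on_eq_continuous_at)
  have "dist (partial i (partial j h) x) (partial j (partial i h) x) \<le> 0 + e" if "e > 0" for e
  proof -
    obtain d1 where d1: "d1 > 0" "\<And>y. dist y x < d1 \<Longrightarrow>
        dist (partial i (partial j h) y) (partial i (partial j h) x) < e/2"
      using c(1) \<open>e > 0\<close> unfolding continuous_at_eps_delta by (metis half_gt_zero)
    obtain d2 where d2: "d2 > 0" "\<And>y. dist y x < d2 \<Longrightarrow>
        dist (partial j (partial i h) y) (partial j (partial i h) x) < e/2"
      using c(2) \<open>e > 0\<close> unfolding continuous_at_eps_delta by (metis half_gt_zero)
    obtain d3 where d3: "d3 > 0" "\<And>y. dist y x < d3 \<Longrightarrow> y \<in> S"
      using assms(1,3) open_dist by metis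
    \<comment> \<open>All points of the small parallelogram have distance at most
      \<open>2 * t\<close> from \<open>x\<close>; the divisor 3 keeps this strictly below all three
      radii.\<close>
    define t where "t = min d1 (min d2 d3) / 3"
    have t: "t > 0" using d1 d2 d3 by (simp add: t_def)
    have near: "dist (x + axis k s + axis l r) x < d1" "dist (x + axis k s + axis l r) x < d2"
       "dist (x + axis k s + axis l r) x < d3"
      if "0 \<le> s" "s \<le> t" "0 \<le> r" "r \<le> t" for k l s r
    proof -
      have "norm (axis k s :: real^2) = norm (s *\<^sub>R axis k 1 :: real^2)" for k s
        by (rule arg_cong[of _ _ norm]) (simp add: vec_eq_iff axis_def)
      then have "dist (x + axis k s + axis l r) x \<le> 2 * t"
        using norm_triangle_ineq[of "axis k s" "axis l r :: real^2"] that
        by (simp add: dist_norm add.assoc)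
      then show "dist (x + axis k s + axis l r) x < d1" "dist (x + axis k s + axis l r) x < d2"
       "dist (x + axis k s + axis l r) x < d3"
        using t by (auto simp: t_def)
    qed
    obtain s r where sr: "0 < s" "s < t" "0 < r" "r < t"
      "h (x + axis i t + axis j t) - h (x + axis i t) - h (x + axis j t) + h x
        = t * t * partial j (partial i h) (x + axis i s + axis j r)"
      using second_difference_mean_value[OF t assms(2), of x i j] near(3) d3(2) by metis
    obtain s' r' where sr': "0 < s'" "s' < t" "0 < r'" "r' < t"
      "h (x + axis j t + axis i t) - h (x + axis j t) - h (x + axis i t) + h x
        = t * t * partial i (partial j h) (x + axis j s' + axis i r')"
      using second_difference_mean_value[OF t assms(2), of x j i] near(3) d3(2) by metis
    have "t * t * partial j (partial i h) (x + axis i s + axis j r)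
      = t * t * partial i (partial j h) (x + axis j s' + axis i r')"
      unfolding sr(5)[symmetric] sr'(5)[symmetric] by (simp add: algebra_simps)
    then have "partial j (partial i h) (x + axis i s + axis j r)
      = partial i (partial j h) (x + axis j s' + axis i r')"
      using t by simp
    moreover have "dist (partial j (partial i h) (x + axis i s + axis j r)) (partial j (partial i h) x) < e/2"
      using sr by (intro d2 near) auto
    moreover have "dist (partial i (partial j h) (x + axis j s' + axis i r')) (partial i (partial j h) x) < e/2"
      using sr' by (intro d1 near) auto
    ultimately show ?thesis
      unfolding dist_real_def by linarith
  qed
  then have "dist (partial i (partial j h) x) (partial j (partial i h) x) \<le> 0"
    by (rule field_le_epsilon)
  then show ?thesis by simp
qed

lemma partial_linear:
  assumes "bounded_linear L" "h differentiable (at x)"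
  shows "partial i (\<lambda>x. L (h x)) x = L (partial i h x)"
  using partial_eq[OF bounded_linear.has_derivative[OF assms(1)], OF assms(2)[unfolded frechet_derivative_works]]
  by (simp add: partial_def)

text \<open>The mean value theorem is real, so the symmetry is transferred through the linear maps
  \<open>Re\<close> and \<open>Im\<close>.\<close>

lemma partial_commute:
  fixes h :: "real^2 \<Rightarrow> complex"
  assumes S: "open S" "Ck_on 2 S h" "x \<in> S"
  shows "partial i (partial j h) x = partial j (partial i h) x"
proof -
  have "L (partial i (partial j h) x) = L (partial j (partial i h) x)"
    if L: "bounded_linear L" for L :: "complex \<Rightarrow> real"
  proof -
    have d: "\<And>y. y \<in> S \<Longrightarrow> h differentiable (at y)"
        "\<And>k y. y \<in> S \<Longrightarrow> partial k h differentiable (at y)"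
      using S by (auto simp: numeral_2_eq_2)
    have "partial k (partial l (\<lambda>x. L (h x))) x = L (partial k (partial l h) x)" for k l
      using partial_cong[OF S(1,3), of "partial l (\<lambda>x. L (h x))" "\<lambda>x. L (partial l h x)"]
        partial_linear[OF L] d S(3) by simp
    then show ?thesis
      using partial_commute_real[OF S(1) Ck_on_linear[OF L S(1,2)] S(3)] by metis
  qed
  from this[OF bounded_linear_Re] this[OF bounded_linear_Im] show ?thesis
    by (simp add: complex_eq_iff)
qed

subsection \<open>Coordinate derivatives on an open subset of a chart\<close>

definition smooth_in :: "'a chart \<Rightarrow> 'a set \<Rightarrow> ('a \<Rightarrow> 'b::real_normed_vector) \<Rightarrow> bool"
  where "smooth_in c W h \<longleftrightarrow> Cinf_on (coord c ` W) (h \<circ> coord_inv c)"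

lemma smooth_in_subset: "smooth_in c W h \<Longrightarrow> V \<subseteq> W \<Longrightarrow> smooth_in c V h"
  unfolding smooth_in_def Cinf_on_def using Ck_on_subset image_mono by metis

named_theorems smooth_intros

text \<open>The region stays variable because it is later a whole chart domain, an overlap of two
  charts, or the part of a chart inside \<open>U\<close>.\<close>

locale chart_region =
  fixes c :: "'a::topological_space chart" and W :: "'a set"
  assumes chart: "is_chart c" and open_W: "open W" and W_subset: "W \<subseteq> cdom c"
begin

lemma coord_inv_coord [simp]: "p \<in> W \<Longrightarrow> coord_inv c (coord c p) = p"
  using chart W_subset unfolding is_chart_def by (metis homeomorphism_apply1 subsetD)

lemma open_image: "open (coord c ` W)"
proof -
  have "openin (top_of_set (coord c ` cdom c)) (coord c ` W)"
    using chart W_subset open_W unfolding is_chart_def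
    by (metis homeomorphism_imp_open_map open_subset)
  then show ?thesis
    using chart openin_open_trans unfolding is_chart_def by blast
qed

lemma pd_cong: "p \<in> W \<Longrightarrow> (\<And>q. q \<in> W \<Longrightarrow> h q = h' q) \<Longrightarrow> pd c i h p = pd c i h' p"
  unfolding pd_def by (rule partial_cong[OF open_image]) auto

lemma smooth_in_cong:
  assumes "\<And>q. q \<in> W \<Longrightarrow> h q = h' q"
  shows "smooth_in c W h \<longleftrightarrow> smooth_in c W h'"
  unfolding smooth_in_def Cinf_on_def
  using assms by (intro all_cong1 Ck_on_cong[OF open_image]) auto

lemma smooth_in_differentiable:
  "smooth_in c W h \<Longrightarrow> p \<in> W \<Longrightarrow> (h \<circ> coord_inv c) differentiable (at (coord c p))"
  unfolding smooth_in_def Cinf_on_def using Ck_on.simps(2) by blast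

lemma smooth_in_has_derivative:
  "smooth_in c W h \<Longrightarrow> p \<in> W \<Longrightarrow> (h \<circ> coord_inv c has_derivative
    frechet_derivative (h \<circ> coord_inv c) (at (coord c p))) (at (coord c p))"
  using smooth_in_differentiable frechet_derivative_works by blast

lemma smooth_in_pd [smooth_intros]:
  assumes "smooth_in c W h"
  shows "smooth_in c W (pd c i h)"
  unfolding smooth_in_def Cinf_on_def
proof
  fix k
  have "Ck_on (Suc k) (coord c ` W) (h \<circ> coord_inv c)"
    using assms unfolding smooth_in_def Cinf_on_def by blast
  then have "Ck_on k (coord c ` W) (partial i (h \<circ> coord_inv c))"
    by simp
  then show "Ck_on k (coord c ` W) (pd c i h \<circ> coord_inv c)"
    by (subst Ck_on_cong[OF open_image, of _ "partial i (h \<circ> coord_inv c)"]) (auto simp: pd_def)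
qed

lemma smooth_in_const [smooth_intros]: "smooth_in c W (\<lambda>p. a)"
  unfolding smooth_in_def Cinf_on_def comp_def by (simp add: Ck_on_const open_image)

lemma smooth_in_linear:
  "bounded_linear L \<Longrightarrow> smooth_in c W h \<Longrightarrow> smooth_in c W (\<lambda>p. L (h p))"
  unfolding smooth_in_def Cinf_on_def comp_def using Ck_on_linear[OF _ open_image] by blast

lemma smooth_in_add [smooth_intros]:
  "smooth_in c W h \<Longrightarrow> smooth_in c W h' \<Longrightarrow> smooth_in c W (\<lambda>p. h p + h' p)"
  unfolding smooth_in_def Cinf_on_def comp_def by (simp add: Ck_on_add open_image)

lemma smooth_in_minus [smooth_intros]: "smooth_in c W h \<Longrightarrow> smooth_in c W (\<lambda>p. - h p)"
  by (rule smooth_in_linear[OF bounded_linear_minus[OF bounded_linear_ident]])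

lemma smooth_in_diff [smooth_intros]:
  "smooth_in c W h \<Longrightarrow> smooth_in c W h' \<Longrightarrow> smooth_in c W (\<lambda>p. h p - h' p)"
  using smooth_in_add[OF _ smooth_in_minus] by fastforce

lemma smooth_in_mult [smooth_intros]:
  fixes h h' :: "'a \<Rightarrow> 'b::real_normed_algebra"
  shows "smooth_in c W h \<Longrightarrow> smooth_in c W h' \<Longrightarrow> smooth_in c W (\<lambda>p. h p * h' p)"
  unfolding smooth_in_def Cinf_on_def comp_def
  by (simp add: Ck_on_bilinear[OF bounded_bilinear_mult] open_image)

lemma smooth_in_sum [smooth_intros]:
  "(\<And>x. x \<in> I \<Longrightarrow> smooth_in c W (h x)) \<Longrightarrow> smooth_in c W (\<lambda>p. \<Sum>x\<in>I. h x p)"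
  by (induction I rule: infinite_finite_induct) (auto intro: smooth_intros)

lemma smooth_in_of_real [smooth_intros]:
  "smooth_in c W h \<Longrightarrow> smooth_in c W (\<lambda>p. of_real (h p) :: 'b::real_normed_algebra_1)"
  by (rule smooth_in_linear[OF bounded_linear_of_real])

lemma smooth_in_Re: "smooth_in c W h \<Longrightarrow> smooth_in c W (\<lambda>p. Re (h p))"
  by (rule smooth_in_linear[OF bounded_linear_Re])

lemma smooth_in_vec_nth [smooth_intros]: "smooth_in c W h \<Longrightarrow> smooth_in c W (\<lambda>p. h p $ i)"
  by (rule smooth_in_linear[OF bounded_linear_vec_nth])

lemma smooth_in_inverse [smooth_intros]:
  fixes h :: "'a \<Rightarrow> 'b::real_normed_field"
  assumes "smooth_in c W h" "\<And>p. p \<in> W \<Longrightarrow> h p \<noteq> 0"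
  shows "smooth_in c W (\<lambda>p. inverse (h p))"
  using assms unfolding smooth_in_def Cinf_on_def comp_def
  by (auto intro!: Ck_on_inverse[OF open_image])

lemma smooth_in_sqrt [smooth_intros]:
  assumes "smooth_in c W h" "\<And>p. p \<in> W \<Longrightarrow> h p > 0"
  shows "smooth_in c W (\<lambda>p. sqrt (h p))"
  using assms unfolding smooth_in_def Cinf_on_def comp_def
  by (auto intro!: Ck_on_sqrt[OF open_image])

lemma pd_const [simp]: "pd c i (\<lambda>q. a) p = 0"
  unfolding pd_def comp_def by (subst partial_eq[OF has_derivative_const]) simp

lemma pd_linear:
  assumes "bounded_linear L" "smooth_in c W h" "p \<in> W"
  shows "pd c i (\<lambda>q. L (h q)) p = L (pd c i h p)"
  using partial_linear[OF assms(1) smooth_in_differentiable[OF assms(2,3)]]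
  unfolding pd_def comp_def .

lemma pd_add:
  assumes "smooth_in c W h" "smooth_in c W h'" "p \<in> W"
  shows "pd c i (\<lambda>q. h q + h' q) p = pd c i h p + pd c i h' p"
  using partial_eq[OF has_derivative_add[OF smooth_in_has_derivative[OF assms(1,3)]
      smooth_in_has_derivative[OF assms(2,3)]]]
  by (simp add: pd_def comp_def partial_def)

lemma pd_minus:
  "smooth_in c W h \<Longrightarrow> p \<in> W \<Longrightarrow> pd c i (\<lambda>q. - h q) p = - pd c i h p"
  by (rule pd_linear[OF bounded_linear_minus[OF bounded_linear_ident]])

lemma pd_diff:
  assumes "smooth_in c W h" "smooth_in c W h'" "p \<in> W"
  shows "pd c i (\<lambda>q. h q - h' q) p = pd c i h p - pd c i h' p"
  using pd_add[OF assms(1) smooth_in_minus[OF assms(2)] assms(3)] pd_minus[OF assms(2,3)] by simp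

lemma pd_mult:
  fixes h h' :: "'a \<Rightarrow> complex"
  assumes "smooth_in c W h" "smooth_in c W h'" "p \<in> W"
  shows "pd c i (\<lambda>q. h q * h' q) p = pd c i h p * h' p + h p * pd c i h' p"
  using partial_eq[OF has_derivative_mult[OF smooth_in_has_derivative[OF assms(1,3)]
      smooth_in_has_derivative[OF assms(2,3)]]] assms(3)
  by (simp add: pd_def comp_def partial_def)

lemma pd_sum:
  assumes "\<And>x. x \<in> I \<Longrightarrow> smooth_in c W (h x)" "p \<in> W"
  shows "pd c i (\<lambda>q. \<Sum>x\<in>I. h x q) p = (\<Sum>x\<in>I. pd c i (h x) p)"
  using assms(1)
proof (induction I rule: infinite_finite_induct)
  case (insert x I)
  then show ?case
    using pd_add[of "h x" "\<lambda>q. \<Sum>x\<in>I. h x q"] assms(2) by (simp add: smooth_intros)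
qed auto

lemma pd_of_real:
  "smooth_in c W h \<Longrightarrow> p \<in> W \<Longrightarrow>
    pd c i (\<lambda>q. of_real (h q)) p = (of_real (pd c i h p) :: complex)"
  by (rule pd_linear[OF bounded_linear_of_real])

lemma pd_commute:
  fixes h :: "'a \<Rightarrow> complex"
  assumes "smooth_in c W h" "p \<in> W"
  shows "pd c i (pd c j h) p = pd c j (pd c i h) p"
proof -
  have "partial k (pd c l h \<circ> coord_inv c) (coord c p)
      = partial k (partial l (h \<circ> coord_inv c)) (coord c p)" for k l
    using assms(2) by (intro partial_cong[OF open_image]) (auto simp: pd_def)
  moreover have "Ck_on 2 (coord c ` W) (h \<circ> coord_inv c)"
    using assms(1) unfolding smooth_in_def Cinf_on_def by blast
  ultimately show ?thesis
    using partial_commute[OF open_image, of "h \<circ> coord_inv c" "coord c p" i j] assms(2)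
    by (simp add: pd_def)
qed

lemmas pd_simps = pd_add pd_diff pd_mult pd_sum pd_minus pd_of_real

end

subsection \<open>Null frames\<close>

definition flip :: "2 \<Rightarrow> 2"
  where "flip b = (if b = 1 then 2 else 1)"

definition sg :: "2 \<Rightarrow> int"
  where "sg b = (if b = 1 then 1 else -1)"

lemma flip_simps [simp]: "flip 1 = 2" "flip 2 = 1" "flip (flip b) = b"
  using exhaust_2[of b] by (auto simp: flip_def)

lemma sg_simps [simp]: "sg 1 = 1" "sg 2 = -1" "sg (flip b) = - sg b"
  using exhaust_2[of b] by (auto simp: sg_def)

locale chart_metric = chart_region c W for c :: "'a::topological_space chart" and W :: "'a set" +
  fixes g :: "'a metric" and K :: real
  assumes g_smooth: "smooth_in c W (g c)"
    and g_sym: "p \<in> W \<Longrightarrow> transpose (g c p) = g c p"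
    and g_pos: "p \<in> W \<Longrightarrow> v \<noteq> 0 \<Longrightarrow> v \<bullet> (g c p *v v) > 0"
    and curvature: "p \<in> W \<Longrightarrow> u \<noteq> v \<Longrightarrow> independent {u, v} \<Longrightarrow> sectional_curvature g c p u v = K"
begin

definition gg :: "2 \<Rightarrow> 2 \<Rightarrow> 'a \<Rightarrow> complex"
  where "gg i j p = of_real (g c p $ i $ j)"

definition Gam :: "2 \<Rightarrow> 2 \<Rightarrow> 2 \<Rightarrow> 'a \<Rightarrow> complex"
  where "Gam l i j p = of_real (christoffel g c l i j p)"

text \<open>On \<open>W\<close> this is the determinant of the symmetric matrix
  \<open>g c p\<close>, up to sign a quarter of the discriminant of the quadratic equation for null
  directions.\<close>

definition disc :: "'a \<Rightarrow> real"
  where "disc p = g c p $ 1 $ 1 * g c p $ 2 $ 2 - g c p $ 1 $ 2 * g c p $ 1 $ 2"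

text \<open>\<open>Z 1\<close> solves the quadratic equation \<open>g(Z,Z) = 0\<close>, and \<open>Z 2\<close> is its complex conjugate,
  scaled such that \<open>g(Z 1, Z 2) = 1\<close>.\<close>

definition Z :: "2 \<Rightarrow> 2 \<Rightarrow> 'a \<Rightarrow> complex"
  where "Z b i p =
    (let z = of_real (if i = 1 then - g c p $ 1 $ 2 else g c p $ 1 $ 1);
         y = \<i> * of_real (if i = 1 then sqrt (disc p) else 0)
     in if b = 1 then z + y else (z - y) * inverse (of_real (2 * g c p $ 1 $ 1 * disc p)))"

text \<open>The dual coframe: for null vectors with g(Z 1, Z 2) = 1, the form dual to
  \<open>Z b\<close> is the metric pairing with \<open>Z (flip b)\<close>.\<close>

definition th :: "2 \<Rightarrow> 2 \<Rightarrow> 'a \<Rightarrow> complex"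
  where "th b i p = (\<Sum>j\<in>UNIV. gg i j p * Z (flip b) j p)"

lemma g_symD: "p \<in> W \<Longrightarrow> g c p $ i $ j = g c p $ j $ i"
  using arg_cong[OF g_sym, of p "\<lambda>A. A $ j $ i"] by (simp add: transpose_def)

lemma g11_pos: "p \<in> W \<Longrightarrow> g c p $ 1 $ 1 > 0"
  using g_pos[of p "axis 1 1"]
  by (simp add: inner_vec_def matrix_vector_mult_def sum_2 axis_def vec_eq_iff)

lemma disc_pos:
  assumes "p \<in> W"
  shows "disc p > 0"
proof -
  let ?v = "vector [- g c p $ 1 $ 2, g c p $ 1 $ 1] :: real^2"
  have "?v \<noteq> 0"
    using g11_pos[OF assms] by (simp add: vec_eq_iff forall_2)
  from g_pos[OF assms this] have "g c p $ 1 $ 1 * disc p > 0"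
    using g_symD[OF assms, of 2 1]
    by (simp add: inner_vec_def matrix_vector_mult_def sum_2 disc_def algebra_simps)
  then show ?thesis
    using g11_pos[OF assms] by (simp add: zero_less_mult_iff)
qed

lemma gg_sym: "p \<in> W \<Longrightarrow> gg i j p = gg j i p"
  using g_symD[of p i j] by (simp add: gg_def)

lemma Z_metric:
  assumes "p \<in> W"
  shows "(\<Sum>i\<in>UNIV. \<Sum>j\<in>UNIV. gg i j p * Z a i p * Z b j p) = (if a = b then 0 else 1)"
proof -
  define e f h r where "e = gg 1 1 p" and "f = gg 1 2 p" and "h = gg 2 2 p"
    and "r = complex_of_real (sqrt (disc p))"
  have "sqrt (disc p) * sqrt (disc p) = disc p"
    using disc_pos[OF assms] by simp
  then have r: "of_real (disc p) = r * r"
    unfolding r_def by (metis of_real_mult)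
  have "of_real (disc p) = e * h - f * f"
    by (simp add: e_def f_def h_def gg_def disc_def)
  with r have rr: "r * r = e * h - f * f" by simp
  have nz: "e \<noteq> 0" "r \<noteq> 0"
    using g11_pos[OF assms] disc_pos[OF assms] by (auto simp: e_def r_def gg_def)
  define s where "s = inverse (2 * e * (r * r))"
  have s: "s * (2 * e * (r * r)) = 1"
    unfolding s_def by (rule left_inverse) (use nz in simp)
  have Z: "Z 1 1 p = - f + \<i> * r" "Z 1 2 p = e" "Z 2 1 p = (- f - \<i> * r) * s" "Z 2 2 p = e * s"
    by (simp_all add: Z_def s_def e_def f_def gg_def r_def r[unfolded r_def])
  have g: "gg 1 1 p = e" "gg 1 2 p = f" "gg 2 1 p = f" "gg 2 2 p = h"
    using gg_sym[OF assms] by (auto simp: e_def f_def h_def)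
  have i: "\<i> * \<i> = -1" by simp
  \<comment> \<open>The imaginary unit, the square root and the inverse enter only through the
    polynomial relations \<open>i\<close>, \<open>rr\<close> and \<open>s\<close>, which leaves
    polynomial identities.\<close>
  have "\<forall>a b. (\<Sum>i\<in>UNIV. \<Sum>j\<in>UNIV. gg i j p * Z a i p * Z b j p) = (if a = b then 0 else 1)"
    unfolding forall_2 sum_2 Z g using s rr i by (auto; algebra)
  then show ?thesis by blast
qed

lemma th_Z: "p \<in> W \<Longrightarrow> (\<Sum>i\<in>UNIV. th a i p * Z b i p) = (if a = b then 1 else 0)"
  using Z_metric[of p b "flip a"] exhaust_2[of a] exhaust_2[of b]
  by (elim disjE) (simp_all add: th_def sum_2 distrib_right distrib_left mult_ac add_ac)

text \<open>By \<open>th_Z\<close> the matrices of coframe and frame are inverse in one order, hence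
  also in the other.\<close>

lemma Z_th:
  assumes "p \<in> W"
  shows "(\<Sum>b\<in>UNIV. Z b i p * th b j p) = (if i = j then 1 else 0)"
proof -
  have "\<forall>i j. (\<Sum>b\<in>UNIV. Z b i p * th b j p) = (if i = j then 1 else 0)"
    using th_Z[OF assms, of 1 1] th_Z[OF assms, of 1 2] th_Z[OF assms, of 2 1] th_Z[OF assms, of 2 2]
    unfolding forall_2 sum_2 by (auto; algebra)
  then show ?thesis by blast
qed

lemma gg_eq:
  assumes "p \<in> W"
  shows "gg i j p = th 1 i p * th 2 j p + th 2 i p * th 1 j p"
proof -
  have "(\<Sum>b\<in>UNIV. th b i p * th (flip b) j p) = (\<Sum>b\<in>UNIV. \<Sum>k\<in>UNIV. th b i p * gg j k p * Z b k p)"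
    by (simp add: th_def[of "flip _"] sum_distrib_left mult.assoc)
  also have "\<dots> = (\<Sum>k\<in>UNIV. gg j k p * (\<Sum>b\<in>UNIV. Z b k p * th b i p))"
    by (subst sum.swap) (simp add: sum_distrib_left mult_ac)
  also have "\<dots> = gg i j p"
    using gg_sym[OF assms] by (simp add: Z_th[OF assms] if_distrib cong: if_cong)
  finally show ?thesis by (simp add: sum_2)
qed

lemma g_ginv: "p \<in> W \<Longrightarrow> (\<Sum>l\<in>UNIV. g c p $ m $ l * ginv g c p $ l $ n) = (if m = n then 1 else 0)"
  and ginv_g: "p \<in> W \<Longrightarrow> (\<Sum>l\<in>UNIV. ginv g c p $ m $ l * g c p $ l $ n) = (if m = n then 1 else 0)"
proof -
  assume p: "p \<in> W"
  have "det (g c p) \<noteq> 0"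
    using disc_pos[OF p] g_symD[OF p, of 2 1] by (simp add: det_2 disc_def)
  then have "\<exists>B. g c p ** B = mat 1 \<and> B ** g c p = mat 1"
    by (simp add: invertible_det_nz[symmetric] invertible_def)
  then have inv: "g c p ** ginv g c p = mat 1" "ginv g c p ** g c p = mat 1"
    unfolding ginv_def matrix_inv_def by (rule someI2_ex; blast)+
  show "(\<Sum>l\<in>UNIV. g c p $ m $ l * ginv g c p $ l $ n) = (if m = n then 1 else 0)"
    using inv(1) by (simp add: matrix_matrix_mult_def mat_def vec_eq_iff)
  show "(\<Sum>l\<in>UNIV. ginv g c p $ m $ l * g c p $ l $ n) = (if m = n then 1 else 0)"
    using inv(2) by (simp add: matrix_matrix_mult_def mat_def vec_eq_iff)
qed

text \<open>The right-hand side is a right inverse of the metric by \<open>Z_th\<close>, so it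
  agrees with the inverse.\<close>

lemma ginv_eq:
  assumes "p \<in> W"
  shows "of_real (ginv g c p $ i $ j) = Z 1 i p * Z 2 j p + Z 2 i p * Z 1 j p"
proof -
  let ?X = "\<lambda>i. Z 1 i p * Z 2 j p + Z 2 i p * Z 1 j p"
  have 1: "(\<Sum>l\<in>UNIV. gg m l p * ?X l) = (if m = j then 1 else 0)" for m
    using Z_th[OF assms, of j m] by (simp add: th_def sum_2 algebra_simps)
  have "?X i = (\<Sum>l\<in>UNIV. of_real (\<Sum>m\<in>UNIV. ginv g c p $ i $ m * g c p $ m $ l) * ?X l)"
    by (simp add: ginv_g[OF assms] if_distrib[of of_real] if_distrib[of "\<lambda>a. a * _"] cong: if_cong)
  also have "\<dots> = (\<Sum>m\<in>UNIV. of_real (ginv g c p $ i $ m) * (\<Sum>l\<in>UNIV. gg m l p * ?X l))"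
    by (simp add: sum_2 gg_def algebra_simps)
  also have "\<dots> = of_real (ginv g c p $ i $ j)"
    by (simp add: 1 if_distrib cong: if_cong)
  finally show ?thesis by simp
qed

lemma gg_smooth [smooth_intros]: "smooth_in c W (gg i j)"
  unfolding gg_def[abs_def] by (intro smooth_intros g_smooth)

lemma Z_smooth [smooth_intros]: "smooth_in c W (Z b i)"
proof -
  have 1: "smooth_in c W disc"
    unfolding disc_def[abs_def] by (intro smooth_intros g_smooth)
  have 2: "smooth_in c W (\<lambda>p. if i = 1 then - g c p $ 1 $ 2 else g c p $ 1 $ 1)"
    by (cases "i = 1") (auto intro!: smooth_intros g_smooth)
  have 3: "smooth_in c W (\<lambda>p. if i = 1 then sqrt (disc p) else 0)"
    by (cases "i = 1") (auto intro!: smooth_intros 1 disc_pos)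
  have 4: "smooth_in c W (\<lambda>p. inverse (complex_of_real (2 * g c p $ 1 $ 1 * disc p)))"
  proof (intro smooth_intros g_smooth 1)
    fix p assume "p \<in> W"
    then show "complex_of_real (2 * g c p $ 1 $ 1 * disc p) \<noteq> 0"
      using g11_pos[of p] disc_pos[of p] by auto
  qed
  show ?thesis
    unfolding Z_def[abs_def] Let_def
    by (cases "b = 1") (simp_all only: simp_thms if_True if_False smooth_in_mult[OF _ 4] smooth_intros 2 3)
qed

lemma th_smooth [smooth_intros]: "smooth_in c W (th b i)"
  unfolding th_def[abs_def] by (intro smooth_intros)

lemma christoffel_smooth: "smooth_in c W (christoffel g c l i j)"
proof -
  have "smooth_in c W (\<lambda>p. ginv g c p $ i $ j)" for i j
  proof -
    \<comment> \<open>The smoothness of the inverse metric is read off from its frame expression,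
      without differentiating \<open>matrix_inv\<close>.\<close>
    have "smooth_in c W (\<lambda>p. Re (Z 1 i p * Z 2 j p + Z 2 i p * Z 1 j p))"
      by (intro smooth_in_Re smooth_intros)
    then show ?thesis
      by (subst smooth_in_cong[of _ "\<lambda>p. Re (Z 1 i p * Z 2 j p + Z 2 i p * Z 1 j p)"])
        (simp_all add: ginv_eq[symmetric])
  qed
  then show ?thesis
    unfolding christoffel_def[abs_def]
    by (intro smooth_in_mult smooth_in_sum smooth_in_add smooth_in_diff smooth_in_pd
        smooth_in_const smooth_in_vec_nth[OF smooth_in_vec_nth[OF g_smooth]])
qed

lemma Gam_smooth [smooth_intros]: "smooth_in c W (Gam l i j)"
  unfolding Gam_def[abs_def] by (intro smooth_intros christoffel_smooth)

text \<open>Lowering the upper index cancels the inverse metric and leaves the Christoffel symbols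
  of the first kind.\<close>

lemma g_christoffel:
  assumes "p \<in> W"
  shows "(\<Sum>l\<in>UNIV. gg m l p * Gam l i j p)
    = (pd c i (gg j m) p + pd c j (gg i m) p - pd c m (gg i j) p) / 2"
proof -
  let ?B = "\<lambda>m. pd c i (\<lambda>q. g c q $ j $ m) p + pd c j (\<lambda>q. g c q $ i $ m) p
    - pd c m (\<lambda>q. g c q $ i $ j) p"
  have "(\<Sum>l\<in>UNIV. g c p $ m $ l * christoffel g c l i j p)
      = 1/2 * (\<Sum>n\<in>UNIV. (\<Sum>l\<in>UNIV. g c p $ m $ l * ginv g c p $ l $ n) * ?B n)"
    by (simp add: christoffel_def sum_2 algebra_simps)
  also have "\<dots> = ?B m / 2"
    by (simp add: g_ginv[OF assms] if_distrib[of "\<lambda>a. a * _"] cong: if_cong)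
  finally have "complex_of_real (\<Sum>l\<in>UNIV. g c p $ m $ l * christoffel g c l i j p) = of_real (?B m / 2)"
    by (rule arg_cong)
  moreover have "pd c k (gg i j) p = of_real (pd c k (\<lambda>q. g c q $ i $ j) p)" for i j k
    unfolding gg_def[abs_def] using assms by (intro pd_of_real smooth_intros g_smooth)
  ultimately show ?thesis
    by (simp add: gg_def Gam_def del: sum_divide_distrib)
qed

lemma pd_gg_sym: "p \<in> W \<Longrightarrow> pd c k (gg i j) p = pd c k (gg j i) p"
  by (rule pd_cong) (auto simp: gg_sym)

text \<open>Metric compatibility of the connection: in the sum of two symbols of the first kind, all
  but one derivative of the metric cancel.\<close>

lemma pd_gg:
  assumes "p \<in> W"
  shows "pd c i (gg j k) p
    = (\<Sum>l\<in>UNIV. gg k l p * Gam l i j p) + (\<Sum>l\<in>UNIV. gg j l p * Gam l i k p)"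
  using pd_gg_sym[OF assms, of i k j]
  by (simp add: g_christoffel[OF assms] field_simps)

lemma Gam_sym:
  assumes "p \<in> W"
  shows "Gam l i j p = Gam l j i p"
proof -
  have "pd c m (\<lambda>q. g c q $ i $ j) p = pd c m (\<lambda>q. g c q $ j $ i) p" for m
    using pd_cong[OF assms g_symD] .
  then have "christoffel g c l i j p = christoffel g c l j i p"
    unfolding christoffel_def by (simp only: add.commute)
  then show ?thesis by (simp add: Gam_def)
qed

end

section \<open>The connection form of the null frame and its curvature\<close>

context chart_metric
begin

definition nabla_Z :: "2 \<Rightarrow> 2 \<Rightarrow> 2 \<Rightarrow> 'a \<Rightarrow> complex"
  where "nabla_Z i b l p = pd c i (Z b l) p + (\<Sum>m\<in>UNIV. Gam l i m p * Z b m p)"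

definition al :: "2 \<Rightarrow> 'a \<Rightarrow> complex"
  where "al i p = (\<Sum>l\<in>UNIV. th 1 l p * nabla_Z i 1 l p)"

lemma al_smooth [smooth_intros]: "smooth_in c W (al i)"
  unfolding al_def[abs_def] nabla_Z_def by (intro smooth_intros)

text \<open>Since \<open>th (flip b)\<close> is the metric pairing with \<open>Z b\<close>, this is
  the derivative of the constant g(Z a, Z b), computed with metric compatibility.\<close>

lemma nabla_Z_compat:
  assumes "p \<in> W"
  shows "(\<Sum>l\<in>UNIV. th (flip b) l p * nabla_Z i a l p) + (\<Sum>l\<in>UNIV. th (flip a) l p * nabla_Z i b l p) = 0"
proof -
  have "pd c i (\<lambda>p. \<Sum>j\<in>UNIV. \<Sum>k\<in>UNIV. gg j k p * Z a j p * Z b k p) p = 0"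
    using pd_cong[OF assms, of "\<lambda>p. \<Sum>j\<in>UNIV. \<Sum>k\<in>UNIV. gg j k p * Z a j p * Z b k p"
      "\<lambda>p. if a = b then 0 else 1" i] Z_metric by simp
  moreover have "pd c i (\<lambda>p. \<Sum>j\<in>UNIV. \<Sum>k\<in>UNIV. gg j k p * Z a j p * Z b k p) p
    = (\<Sum>j\<in>UNIV. \<Sum>k\<in>UNIV. (pd c i (gg j k) p * Z a j p + gg j k p * pd c i (Z a j) p) * Z b k p
        + gg j k p * Z a j p * pd c i (Z b k) p)"
    using assms by (simp add: pd_simps smooth_intros)
  ultimately have E: "(\<Sum>j\<in>UNIV. \<Sum>k\<in>UNIV. (pd c i (gg j k) p * Z a j p + gg j k p * pd c i (Z a j) p) * Z b k p
        + gg j k p * Z a j p * pd c i (Z b k) p) = 0" by simp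
  have s: "gg 2 1 p = gg 1 2 p"
    by (rule gg_sym[OF assms])
  show ?thesis
    using E unfolding pd_gg[OF assms] nabla_Z_def th_def flip_simps sum_2 s by algebra
qed

text \<open>By \<open>nabla_Z_compat\<close> with equal indices, the derivative of
  \<open>Z b\<close> has no component along \<open>Z (flip b)\<close>; with different indices, the
  two diagonal coefficients are opposite. So \<open>al\<close> is the only connection
  coefficient.\<close>

lemma nabla_Z_eq:
  assumes "p \<in> W"
  shows "nabla_Z i b l p = of_int (sg b) * al i p * Z b l p"
proof -
  have "nabla_Z i b l p = (\<Sum>m\<in>UNIV. (if l = m then 1 else 0) * nabla_Z i b m p)"
    by (simp add: if_distrib[of "\<lambda>a. a * _"] cong: if_cong)
  also have "\<dots> = Z 1 l p * (\<Sum>m\<in>UNIV. th 1 m p * nabla_Z i b m p)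
      + Z 2 l p * (\<Sum>m\<in>UNIV. th 2 m p * nabla_Z i b m p)"
    unfolding Z_th[OF assms, symmetric] by (simp add: sum_2 algebra_simps)
  finally have e: "nabla_Z i b l p = Z 1 l p * (\<Sum>m\<in>UNIV. th 1 m p * nabla_Z i b m p)
      + Z 2 l p * (\<Sum>m\<in>UNIV. th 2 m p * nabla_Z i b m p)" .
  have b: "b = 1 \<or> b = 2" by (rule exhaust_2)
  then show ?thesis
  proof
    assume "b = 1"
    moreover have "(\<Sum>m\<in>UNIV. th 2 m p * nabla_Z i 1 m p) = 0"
      using nabla_Z_compat[OF assms, of 1 i 1] by simp
    ultimately show ?thesis
      unfolding e by (simp add: al_def mult.commute)
  next
    assume "b = 2"
    moreover have "(\<Sum>m\<in>UNIV. th 1 m p * nabla_Z i 2 m p) = 0"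
      using nabla_Z_compat[OF assms, of 2 i 2] by simp
    moreover have "(\<Sum>m\<in>UNIV. th 2 m p * nabla_Z i 2 m p) = - al i p"
      using nabla_Z_compat[OF assms, of 1 i 2] by (simp add: al_def add_eq_0_iff)
    ultimately show ?thesis
      unfolding e by simp
  qed
qed

lemma pd_Z:
  assumes "p \<in> W"
  shows "pd c i (Z b l) p = of_int (sg b) * al i p * Z b l p - (\<Sum>m\<in>UNIV. Gam l i m p * Z b m p)"
  using nabla_Z_eq[OF assms, of i b l] by (simp add: nabla_Z_def eq_diff_eq)

text \<open>The coframe is obtained by lowering the index of \<open>Z (flip b)\<close>, whose sign
  is opposite, and the metric is parallel.\<close>

lemma pd_th:
  assumes "p \<in> W"
  shows "pd c i (th b j) p = (\<Sum>m\<in>UNIV. Gam m i j p * th b m p) - of_int (sg b) * al i p * th b j p"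
proof -
  have "pd c i (th b j) p = (\<Sum>k\<in>UNIV. pd c i (gg j k) p * Z (flip b) k p + gg j k p * pd c i (Z (flip b) k) p)"
    unfolding th_def[abs_def] using assms by (simp add: pd_simps smooth_intros)
  then show ?thesis
    unfolding pd_gg[OF assms] pd_Z[OF assms] th_def sum_2 sg_simps of_int_minus gg_sym[OF assms, of 2 1]
    by algebra
qed

definition kappa :: "'a \<Rightarrow> complex"
  where "kappa p = pd c 1 (al 2) p - pd c 2 (al 1) p"

text \<open>Apply \<open>pd_Z\<close> twice and use that mixed derivatives of the frame components
  commute. The terms quadratic in \<open>al\<close> cancel because the connection is diagonal, so
  only its exterior derivative \<open>kappa\<close> survives.\<close>

lemma riemann_Z:
  assumes "p \<in> W"
  shows "(\<Sum>m\<in>UNIV. of_real (riemann g c l m 1 2 p) * Z b m p) = of_int (sg b) * kappa p * Z b l p"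
proof -
  define s :: complex where "s = of_int (sg b)"
  have "pd c i (pd c j (Z b l)) p
    = pd c i (\<lambda>p. s * al j p * Z b l p - (\<Sum>m\<in>UNIV. Gam l j m p * Z b m p)) p" for i j
    using assms pd_Z by (intro pd_cong) (auto simp: s_def)
  also have "\<dots> i j = s * pd c i (al j) p * Z b l p + s * al j p * pd c i (Z b l) p
      - (\<Sum>m\<in>UNIV. pd c i (Gam l j m) p * Z b m p + Gam l j m p * pd c i (Z b m) p)" for i j
    using assms by (simp add: pd_simps smooth_intros)
  finally have E: "pd c i (pd c j (Z b l)) p = s * pd c i (al j) p * Z b l p + s * al j p * pd c i (Z b l) p
      - (\<Sum>m\<in>UNIV. pd c i (Gam l j m) p * Z b m p + Gam l j m p * pd c i (Z b m) p)" for i j .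
  have R: "of_real (riemann g c l m 1 2 p) = pd c 1 (Gam l 2 m) p - pd c 2 (Gam l 1 m) p
     + (\<Sum>n\<in>UNIV. Gam l 1 n p * Gam n 2 m p - Gam l 2 n p * Gam n 1 m p)" for m
  proof -
    have "pd c k (Gam l i j) p = of_real (pd c k (christoffel g c l i j) p)" for k i j
      unfolding Gam_def[abs_def] using assms by (intro pd_of_real christoffel_smooth)
    then show ?thesis
      by (simp add: riemann_def Gam_def)
  qed
  have "pd c 1 (pd c 2 (Z b l)) p = pd c 2 (pd c 1 (Z b l)) p"
    using assms by (intro pd_commute smooth_intros)
  then show ?thesis
    unfolding E R kappa_def pd_Z[OF assms] sum_2 s_def[symmetric] by algebra
qed

definition Zdet :: "'a \<Rightarrow> complex"
  where "Zdet p = Z 1 1 p * Z 2 2 p - Z 1 2 p * Z 2 1 p"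

text \<open>The left-hand side is d\<alpha>(Z 1, Z 2). The curvature hypothesis is evaluated on the
  two coordinate vectors and rewritten in the frame by \<open>riemann_Z\<close>.\<close>

lemma kappa_Zdet:
  assumes "p \<in> W"
  shows "kappa p * Zdet p = of_real K"
proof -
  define R where "R l m = complex_of_real (riemann g c l m 1 2 p)" for l m
  define D where "D = th 1 1 p * th 2 2 p - th 1 2 p * th 2 1 p"
  have u: "axis 1 1 \<noteq> (axis 2 1 :: real^2)"
    by (simp add: axis_eq_axis)
  have ind: "independent {axis 1 1, axis 2 1 :: real^2}"
    by (rule independent_mono[OF independent_Basis]) (auto simp: Basis_vec_def)
  have d: "disc p \<noteq> 0"
    using disc_pos[OF assms] by simp
  have v: "axis 1 1 $ (2::2) = (0::real)" "axis 2 1 $ (1::2) = (0::real)"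
      "axis k 1 $ k = (1::real)" for k :: 2
    by (auto simp: axis_def)
  have "sectional_curvature g c p (axis 1 1) (axis 2 1)
      = (\<Sum>l\<in>UNIV. riemann g c l 2 1 2 p * g c p $ l $ 1) / disc p"
    unfolding sectional_curvature_def Let_def inner_vec_def matrix_vector_mult_def
    by (simp add: sum_2 v disc_def power2_eq_square)
  then have "(\<Sum>l\<in>UNIV. riemann g c l 2 1 2 p * g c p $ l $ 1) = K * disc p"
    using curvature[OF assms u ind] d by (simp add: field_simps)
  then have "(\<Sum>l\<in>UNIV. R l 2 * gg l 1 p) = of_real K * of_real (disc p)"
    unfolding R_def gg_def of_real_mult[symmetric] of_real_sum[symmetric] by simp
  moreover have "of_real (disc p) = gg 1 1 p * gg 2 2 p - gg 1 2 p * gg 1 2 p"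
    by (simp add: disc_def gg_def)
  ultimately have 1: "(\<Sum>l\<in>UNIV. R l 2 * gg l 1 p) = of_real K * (gg 1 1 p * gg 2 2 p - gg 1 2 p * gg 1 2 p)"
    by simp
  have 2: "R l m = kappa p * (Z 1 l p * th 1 m p - Z 2 l p * th 2 m p)" for l m
  proof -
    have "R l m = (\<Sum>n\<in>UNIV. R l n * (if n = m then 1 else 0))"
      by (simp add: if_distrib cong: if_cong)
    also have "\<dots> = (\<Sum>b\<in>UNIV. (\<Sum>n\<in>UNIV. R l n * Z b n p) * th b m p)"
      unfolding Z_th[OF assms, symmetric] by (simp add: sum_2 algebra_simps)
    finally show ?thesis
      unfolding R_def riemann_Z[OF assms] by (simp add: sum_2 algebra_simps)
  qed
  \<comment> \<open>Here \<open>D\<close> is the determinant of the coframe, and by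
    \<open>gg_eq\<close> the determinant of the metric is \<open>- (D * D)\<close>, which explains
    the signs.\<close>
  have 3: "- kappa p * D = - of_real K * (D * D)"
    using 1 th_Z[OF assms, of 1 1] th_Z[OF assms, of 1 2] th_Z[OF assms, of 2 1] th_Z[OF assms, of 2 2]
    unfolding 2 D_def sum_2 gg_eq[OF assms] by (simp, algebra)
  have 4: "Zdet p * D = 1"
    using th_Z[OF assms, of 1 1] th_Z[OF assms, of 1 2] th_Z[OF assms, of 2 1] th_Z[OF assms, of 2 2]
    unfolding D_def Zdet_def sum_2 by (simp, algebra)
  from 3 4 show ?thesis
    by algebra
qed

text \<open>The gradient is \<open>P 2\<close> times \<open>Z 1\<close> plus \<open>P 1\<close>
  times \<open>Z 2\<close>, and the divergences of \<open>Z 1\<close> and \<open>Z 2\<close> are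
  \<alpha>(Z 1) and -\<alpha>(Z 2). The right-hand side is therefore the sum of the components of
  the second derivative at the words 12 and 21.\<close>

lemma laplacian_frame:
  assumes f: "smooth_in c W f" and p: "p \<in> W"
  defines "P \<equiv> \<lambda>b p. \<Sum>i\<in>UNIV. Z b i p * pd c i f p"
  shows "laplacian g c f p = (\<Sum>i\<in>UNIV. Z 1 i p * (pd c i (P 2) p + al i p * P 2 p))
    + (\<Sum>i\<in>UNIV. Z 2 i p * (pd c i (P 1) p - al i p * P 1 p))"
proof -
  have P: "smooth_in c W (P b)" for b
    unfolding P_def by (intro smooth_intros f)
  have G: "grad g c f i q = Z 1 i q * P 2 q + Z 2 i q * P 1 q" if "q \<in> W" for i q
    by (simp add: grad_def ginv_eq[OF that] P_def sum_2 algebra_simps)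
  have "pd c i (grad g c f i) p = pd c i (\<lambda>q. Z 1 i q * P 2 q + Z 2 i q * P 1 q) p" for i
    using G by (intro pd_cong[OF p])
  also have "\<dots> i = pd c i (Z 1 i) p * P 2 p + Z 1 i p * pd c i (P 2) p
      + (pd c i (Z 2 i) p * P 1 p + Z 2 i p * pd c i (P 1) p)" for i
    using p by (simp add: pd_simps smooth_intros P)
  finally have D: "pd c i (grad g c f i) p = pd c i (Z 1 i) p * P 2 p + Z 1 i p * pd c i (P 2) p
      + (pd c i (Z 2 i) p * P 1 p + Z 2 i p * pd c i (P 1) p)" for i .
  show ?thesis
    unfolding laplacian_def divergence_def D G[OF p] Gam_def[symmetric] pd_Z[OF p] sum_2
    by (simp add: algebra_simps)
qed

end

subsection \<open>Words in the frame indices\<close>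

lemma finite_words [simp]: "finite {I :: 2 list. length I = k}"
  using finite_lists_length_eq[of "UNIV :: 2 set" k] by simp

lemma sum_words_Suc:
  "(\<Sum>I | length I = Suc k. h I) = (\<Sum>i\<in>UNIV. \<Sum>I | length I = k. h (i # I :: 2 list))"
proof -
  have "(\<Sum>I | length I = Suc k. h I) = (\<Sum>(i, I)\<in>UNIV \<times> {I. length I = k}. h (i # I))"
    by (rule sum.reindex_bij_witness[of _ "\<lambda>(i, I). i # I" "\<lambda>I. (hd I, tl I)"])
      (auto simp: length_Suc_conv)
  then show ?thesis
    by (simp add: sum.cartesian_product)
qed

definition wt :: "2 list \<Rightarrow> int"
  where "wt w = sum_list (map sg w)"

lemma wt_simps [simp]: "wt [] = 0" "wt (b # w) = sg b + wt w"
  by (simp_all add: wt_def)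

lemma wt_map_flip [simp]: "wt (map flip w) = - wt w"
  by (induction w) auto

text \<open>An entry of the tensor power of the matrix \<open>M\<close>, with rows and columns
  indexed by words of equal length. Thus \<open>tprod_compose\<close> says that tensor powers
  respect matrix products.\<close>

definition tprod :: "(2 \<Rightarrow> 2 \<Rightarrow> complex) \<Rightarrow> 2 list \<Rightarrow> 2 list \<Rightarrow> complex"
  where "tprod M w I = (\<Prod>r<length w. M (w ! r) (I ! r))"

lemma tprod_simps [simp]:
  "tprod M [] I = 1"
  "tprod M (b # w) (i # I) = M b i * tprod M w I"
  by (simp_all add: tprod_def prod.lessThan_Suc_shift del: prod.lessThan_Suc)

lemma tprod_compose:
  "length w = length J \<Longrightarrow>
    (\<Sum>I | length I = length w. tprod M w I * tprod N I J) = tprod (\<lambda>a b. \<Sum>i\<in>UNIV. M a i * N i b) w J"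
proof (induction w J rule: list_induct2)
  case (Cons b w j J)
  have "(\<Sum>i\<in>UNIV. \<Sum>I | length I = length w. tprod M (b # w) (i # I) * tprod N (i # I) (j # J))
    = (\<Sum>i\<in>UNIV. M b i * N i j) * (\<Sum>I | length I = length w. tprod M w I * tprod N I J)"
    by (simp add: sum_product mult_ac)
  with Cons show ?case
    by (simp add: sum_words_Suc)
qed simp

lemma tprod_transpose: "length w = length I \<Longrightarrow> tprod M w I = tprod (\<lambda>a b. M b a) I w"
  by (simp add: tprod_def)

text \<open>Each row has a single nonzero entry, and the exponents \<open>sg a\<close> add up to the
  weight of the word.\<close>

lemma tprod_monomial:
  assumes "t \<noteq> 0" "length w = length v"
  shows "tprod (\<lambda>a b. if b = \<sigma> a then t powi sg a else 0) w v
    = (if v = map \<sigma> w then t powi wt w else 0)"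
  using assms(2) by (induction w v rule: list_induct2) (auto simp: power_int_add assms(1))

lemma tprod_delta:
  "length w = length v \<Longrightarrow> tprod (\<lambda>a b. if a = b then 1 else 0) w v = (if w = v then 1 else 0)"
  by (induction w v rule: list_induct2) auto

text \<open>Exchanging \<open>m\<close> with the letter at position \<open>r\<close> is an
  involution on pairs of a word and a letter. This moves Christoffel terms from one factor of a
  contraction to the other.\<close>

lemma sum_words_update:
  fixes T Y :: "2 list \<Rightarrow> complex" and a :: "2 \<Rightarrow> 2 \<Rightarrow> complex"
  assumes "r < k"
  shows "(\<Sum>I | length I = k. (\<Sum>m\<in>UNIV. a m (I ! r) * T (I[r := m])) * Y I)
    = (\<Sum>I | length I = k. T I * (\<Sum>m\<in>UNIV. a (I ! r) m * Y (I[r := m])))"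
proof -
  have "(\<Sum>(I, m)\<in>{I. length I = k} \<times> UNIV. a m (I ! r) * T (I[r := m]) * Y I)
    = (\<Sum>(I, m)\<in>{I. length I = k} \<times> UNIV. T I * (a (I ! r) m * Y (I[r := m])))"
    using assms by (intro sum.reindex_bij_witness[of _ "\<lambda>(I, m). (I[r := m], I ! r)"
          "\<lambda>(I, m). (I[r := m], I ! r)"]) auto
  then show ?thesis
    by (simp add: sum.cartesian_product[symmetric] sum_distrib_left sum_distrib_right)
qed

lemma sum_words_updates:
  fixes T Y :: "2 list \<Rightarrow> complex" and a :: "2 \<Rightarrow> 2 \<Rightarrow> complex"
  shows "(\<Sum>I | length I = k. (\<Sum>r<length I. \<Sum>m\<in>UNIV. a m (I ! r) * T (I[r := m])) * Y I)
    = (\<Sum>I | length I = k. T I * (\<Sum>r<length I. \<Sum>m\<in>UNIV. a (I ! r) m * Y (I[r := m])))"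
proof -
  have "(\<Sum>I | length I = k. (\<Sum>r<length I. \<Sum>m\<in>UNIV. a m (I ! r) * T (I[r := m])) * Y I)
    = (\<Sum>r<k. \<Sum>I | length I = k. (\<Sum>m\<in>UNIV. a m (I ! r) * T (I[r := m])) * Y I)"
    by (subst sum.swap) (simp add: sum_distrib_right)
  also have "\<dots> = (\<Sum>r<k. \<Sum>I | length I = k. T I * (\<Sum>m\<in>UNIV. a (I ! r) m * Y (I[r := m])))"
    by (intro sum.cong sum_words_update) auto
  also have "\<dots> = (\<Sum>I | length I = k. T I * (\<Sum>r<length I. \<Sum>m\<in>UNIV. a (I ! r) m * Y (I[r := m])))"
    by (subst sum.swap) (simp add: sum_distrib_left)
  finally show ?thesis .
qed

text \<open>The Leibniz rule for a matrix acting on a tensor product, with the first slot split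
  off.\<close>

lemma sum_update_Cons:
  "(\<Sum>r<length (j # I). \<Sum>m\<in>UNIV. a ((j # I) ! r) m * tprod M (b # w) ((j # I)[r := m]))
    = (\<Sum>m\<in>UNIV. a j m * M b m) * tprod M w I
      + M b j * (\<Sum>r<length I. \<Sum>m\<in>UNIV. a (I ! r) m * tprod M w (I[r := m]))"
  by (simp add: sum.lessThan_Suc_shift sum_distrib_left sum_distrib_right mult_ac
      del: sum.lessThan_Suc)

section \<open>Ladder factors and words in one letter\<close>

text \<open>The factor picked up when a derivative in a null direction lowers the absolute value of
  the weight from \<open>n + 1\<close> to \<open>n\<close>.\<close>

definition ladder :: "complex \<Rightarrow> real \<Rightarrow> nat \<Rightarrow> complex"
  where "ladder lam K n = (of_real K * of_nat (n * Suc n) - lam) / 2"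

text \<open>The word is built up from its right end: a letter that moves the weight away from zero
  costs nothing, one that moves it towards zero costs a ladder factor. In the latter case the weight
  is nonzero, so the truncated subtraction is exact.\<close>

primrec coef :: "complex \<Rightarrow> real \<Rightarrow> 2 list \<Rightarrow> complex"
  where
    "coef lam K [] = 1"
  | "coef lam K (b # w) =
      coef lam K w * (if sg b * wt w \<ge> 0 then 1 else ladder lam K (nat \<bar>wt w\<bar> - 1))"

text \<open>The flip negates both \<open>sg b\<close> and \<open>wt w\<close>, which changes neither
  their product nor the absolute value of the weight.\<close>

lemma coef_map_flip: "coef lam K (map flip w) = coef lam K w"
  by (induction w) auto

definition pure :: "int \<Rightarrow> 2 list"
  where "pure m = (if m \<ge> 0 then replicate (nat m) 1 else replicate (nat (- m)) 2)"

lemma wt_replicate [simp]: "wt (replicate n b) = int n * sg b"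
  by (induction n) (auto simp: algebra_simps)

lemma wt_pure [simp]: "wt (pure m) = m"
  by (simp add: pure_def)

lemma pure_mult_sg: "pure (int n * sg b) = replicate n b"
  using exhaust_2[of b] by (auto simp: pure_def)

lemma Cons_pure:
  assumes "sg b * m \<ge> 0"
  shows "b # pure m = pure (sg b + m)"
proof -
  have "m = int (nat \<bar>m\<bar>) * sg b" "sg b + m = int (Suc (nat \<bar>m\<bar>)) * sg b"
    using assms exhaust_2[of b] by auto
  then show ?thesis
    by (metis pure_mult_sg replicate_Suc)
qed

lemma pure_eq_replicate:
  assumes "sg b * m < 0"
  shows "pure m = replicate (Suc (nat \<bar>m\<bar> - 1)) (flip b)"
    "pure (sg b + m) = replicate (nat \<bar>m\<bar> - 1) (flip b)"
proof -
  have "m = int (Suc (nat \<bar>m\<bar> - 1)) * sg (flip b)" "sg b + m = int (nat \<bar>m\<bar> - 1) * sg (flip b)"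
    using assms exhaust_2[of b] by auto
  then show "pure m = replicate (Suc (nat \<bar>m\<bar> - 1)) (flip b)"
    "pure (sg b + m) = replicate (nat \<bar>m\<bar> - 1) (flip b)"
    by (metis pure_mult_sg)+
qed

section \<open>Frame components of parallel tensors\<close>

context chart_metric
begin

definition Zw :: "2 list \<Rightarrow> 2 list \<Rightarrow> 'a \<Rightarrow> complex"
  where "Zw w I p = tprod (\<lambda>b i. Z b i p) w I"

definition thw :: "2 list \<Rightarrow> 2 list \<Rightarrow> 'a \<Rightarrow> complex"
  where "thw w I p = tprod (\<lambda>b i. th b i p) w I"

lemma Zw_smooth [smooth_intros]: "length w = length I \<Longrightarrow> smooth_in c W (Zw w I)"
  unfolding Zw_def[abs_def] by (induction w I rule: list_induct2) (auto intro!: smooth_intros)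

lemma thw_smooth [smooth_intros]: "length w = length I \<Longrightarrow> smooth_in c W (thw w I)"
  unfolding thw_def[abs_def] by (induction w I rule: list_induct2) (auto intro!: smooth_intros)

text \<open>By the product rule each letter contributes its sign times \<open>al\<close>, so a
  tensor product of frame vectors is parallel up to its weight times \<open>al\<close>.\<close>

lemma pd_Zw:
  assumes "length w = length I" "p \<in> W"
  shows "pd c i (Zw w I) p = of_int (wt w) * al i p * Zw w I p
    - (\<Sum>r<length I. \<Sum>m\<in>UNIV. Gam (I ! r) i m p * Zw w (I[r := m]) p)"
  using assms(1)
proof (induction w I rule: list_induct2)
  case Nil
  then show ?case by (simp add: Zw_def[abs_def])
next
  case (Cons b w j I)
  have "pd c i (Zw (b # w) (j # I)) p = pd c i (\<lambda>p. Z b j p * Zw w I p) p"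
    by (simp add: Zw_def[abs_def])
  also have "\<dots> = pd c i (Z b j) p * Zw w I p + Z b j p * pd c i (Zw w I) p"
    using Cons(1) assms(2) by (simp add: pd_simps smooth_intros)
  finally show ?case
    unfolding Cons.IH pd_Z[OF assms(2)] Zw_def
      sum_update_Cons[of "\<lambda>j m. Gam j i m p"] by (simp add: algebra_simps)
qed

lemma pd_thw:
  assumes "length w = length I" "p \<in> W"
  shows "pd c i (thw w I) p = (\<Sum>r<length I. \<Sum>m\<in>UNIV. Gam m i (I ! r) p * thw w (I[r := m]) p)
    - of_int (wt w) * al i p * thw w I p"
  using assms(1)
proof (induction w I rule: list_induct2)
  case Nil
  then show ?case by (simp add: thw_def[abs_def])
next
  case (Cons b w j I)
  have "pd c i (thw (b # w) (j # I)) p = pd c i (\<lambda>p. th b j p * thw w I p) p"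
    by (simp add: thw_def[abs_def])
  also have "\<dots> = pd c i (th b j) p * thw w I p + th b j p * pd c i (thw w I) p"
    using Cons(1) assms(2) by (simp add: pd_simps smooth_intros)
  finally show ?case
    unfolding Cons.IH pd_th[OF assms(2)] thw_def
      sum_update_Cons[of "\<lambda>j m. Gam m i j p"] by (simp add: algebra_simps)
qed

definition component :: "'a tensor \<Rightarrow> 2 list \<Rightarrow> 'a \<Rightarrow> complex"
  where "component X w p = (\<Sum>J | length J = length w. thw w J p * X c p J)"

text \<open>The factor by which \<open>X\<close> will act on an eigenfunction. It involves no
  eigenfunction and is therefore defined on every chart, also outside \<open>U\<close>.\<close>

definition mu :: "complex \<Rightarrow> nat \<Rightarrow> 'a tensor \<Rightarrow> 'a \<Rightarrow> complex"
  where "mu lam k X p = (\<Sum>w | length w = k. coef lam K w * component X w p)"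

context
  fixes X :: "'a tensor" and k :: nat
  assumes X_smooth: "length J = k \<Longrightarrow> smooth_in c W (\<lambda>p. X c p J)"
    and X_parallel: "p \<in> W \<Longrightarrow> length J = k \<Longrightarrow> cov_deriv_tensor g c i X J p = 0"
begin

lemma component_smooth: "length w = k \<Longrightarrow> smooth_in c W (component X w)"
  unfolding component_def[abs_def] by (intro smooth_intros X_smooth) auto

text \<open>The Christoffel terms of the coframe and those of the parallel tensor cancel by
  \<open>sum_words_updates\<close>; the weight term of \<open>pd_thw\<close> remains.\<close>

lemma pd_component:
  assumes w: "length w = k" and p: "p \<in> W"
  shows "pd c i (component X w) p = - of_int (wt w) * al i p * component X w p"
proof -
  have X: "pd c i (\<lambda>q. X c q J) p = - (\<Sum>r<length J. \<Sum>m\<in>UNIV. Gam (J ! r) i m p * X c p (J[r := m]))"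
    if "length J = k" for J
    using X_parallel[OF p that, of i] by (simp add: cov_deriv_tensor_def Gam_def eq_neg_iff_add_eq_0)
  have "pd c i (component X w) p = (\<Sum>J | length J = k. pd c i (\<lambda>p. thw w J p * X c p J) p)"
    unfolding component_def[abs_def] w using w p X_smooth by (intro pd_sum smooth_intros) auto
  also have "\<dots> = (\<Sum>J | length J = k. pd c i (thw w J) p * X c p J + thw w J p * pd c i (\<lambda>q. X c q J) p)"
    using w p X_smooth by (intro sum.cong refl pd_mult smooth_intros) auto
  also have "\<dots> = (\<Sum>J | length J = k.
      (\<Sum>r<length J. \<Sum>m\<in>UNIV. Gam m i (J ! r) p * thw w (J[r := m]) p) * X c p J
      - of_int (wt w) * al i p * (thw w J p * X c p J)
      - thw w J p * (\<Sum>r<length J. \<Sum>m\<in>UNIV. Gam (J ! r) i m p * X c p (J[r := m])))"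
    using w by (intro sum.cong refl) (simp add: X pd_thw[OF _ p] algebra_simps)
  also have "\<dots> = - of_int (wt w) * al i p * component X w p"
    unfolding component_def w sum_subtractf sum_words_updates[where a = "\<lambda>m j. Gam m i j p"
      and T = "\<lambda>J. thw w J p" and Y = "\<lambda>J. X c p J"]
    by (simp add: sum_distrib_left[symmetric])
  finally show ?thesis .
qed

text \<open>Mixed derivatives of the component commute, so \<open>pd_component\<close> applied twice
  makes weight times \<open>kappa\<close> times component vanish; \<open>kappa\<close> is nonzero by
  \<open>kappa_Zdet\<close>.\<close>

lemma component_eq_0:
  assumes w: "length w = k" "wt w \<noteq> 0" and p: "p \<in> W" and K: "K \<noteq> 0"
  shows "component X w p = 0"
proof -
  let ?E = "component X w" and ?s = "of_int (wt w) :: complex"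
  note [smooth_intros] = component_smooth[OF w(1)]
  have "pd c i (pd c j ?E) p = pd c i (\<lambda>p. - ?s * al j p * ?E p) p" for i j
    using pd_component[OF w(1)] by (intro pd_cong[OF p])
  also have "\<dots> i j = - ?s * pd c i (al j) p * ?E p + - ?s * al j p * pd c i ?E p" for i j
    using p by (simp add: pd_simps smooth_intros)
  finally have D: "pd c i (pd c j ?E) p = - ?s * pd c i (al j) p * ?E p + - ?s * al j p * pd c i ?E p" for i j .
  have "pd c 1 (pd c 2 ?E) p = pd c 2 (pd c 1 ?E) p"
    using p by (intro pd_commute smooth_intros)
  then have "?s * kappa p * ?E p = 0"
    unfolding D pd_component[OF w(1) p] kappa_def by algebra
  moreover have "kappa p \<noteq> 0"
    using kappa_Zdet[OF p] K by auto
  ultimately show ?thesis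
    using w by simp
qed

lemma pd_mu:
  assumes p: "p \<in> W" and K: "K \<noteq> 0"
  shows "pd c i (mu lam k X) p = 0"
proof -
  have "pd c i (mu lam k X) p = (\<Sum>w | length w = k. pd c i (\<lambda>p. coef lam K w * component X w p) p)"
    unfolding mu_def[abs_def] using p by (intro pd_sum smooth_intros component_smooth) auto
  also have "\<dots> = 0"
  proof (intro sum.neutral ballI)
    fix w :: "2 list" assume "w \<in> {w. length w = k}"
    then have w: "length w = k" by simp
    have "pd c i (component X w) p = 0"
      using component_eq_0[OF w _ p K] pd_component[OF w p] by (cases "wt w = 0") auto
    then show "pd c i (\<lambda>p. coef lam K w * component X w p) p = 0"
      using p w by (simp add: pd_simps smooth_intros component_smooth)
  qed
  finally show ?thesis .
qed

lemma mu_smooth: "smooth_in c W (mu lam k X)"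
  unfolding mu_def[abs_def] by (intro smooth_intros component_smooth) auto

end

section \<open>Covariant derivatives along words\<close>

text \<open>The covariant derivative in direction \<open>Z b\<close> of the component of weight \<open>m\<close> of a tensor.\<close>

definition dZ :: "2 \<Rightarrow> int \<Rightarrow> ('a \<Rightarrow> complex) \<Rightarrow> 'a \<Rightarrow> complex"
  where "dZ b m h p = (\<Sum>i\<in>UNIV. Z b i p * (pd c i h p - of_int m * al i p * h p))"

lemma dZ_smooth [smooth_intros]: "smooth_in c W h \<Longrightarrow> smooth_in c W (dZ b m h)"
  unfolding dZ_def[abs_def] by (intro smooth_intros)

lemma dZ_cong: "p \<in> W \<Longrightarrow> (\<And>q. q \<in> W \<Longrightarrow> h q = h' q) \<Longrightarrow> dZ b m h p = dZ b m h' p"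
  unfolding dZ_def using pd_cong[of p h h'] by simp

lemma dZ_scale:
  "smooth_in c W h \<Longrightarrow> p \<in> W \<Longrightarrow> dZ b m (\<lambda>p. a * h p) p = a * dZ b m h p"
  unfolding dZ_def by (simp add: pd_simps smooth_intros sum_2 algebra_simps)

text \<open>The outer weight includes the letter just added, which cancels the \<open>al\<close>
  term in the derivative of that frame vector. The Christoffel terms cancel because the connection
  is torsion-free, and d\<alpha>(Z 1, Z 2) = \<open>K\<close> remains, multiplied by minus the
  weight.\<close>

lemma dZ_commutator:
  assumes h: "smooth_in c W h" and p: "p \<in> W"
  shows "dZ b (sg (flip b) + m) (dZ (flip b) m h) p - dZ (flip b) (sg b + m) (dZ b m h) p
    = - of_int (sg b * m) * of_real K * h p"
proof -
  note [smooth_intros] = h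
  have D: "pd c i (dZ b m h) p = (\<Sum>j\<in>UNIV. pd c i (Z b j) p * (pd c j h p - of_int m * al j p * h p)
     + Z b j p * (pd c i (pd c j h) p - of_int m * (pd c i (al j) p * h p + al j p * pd c i h p)))" for i b
    unfolding dZ_def[abs_def] using p by (simp add: pd_simps smooth_intros algebra_simps)
  have c: "pd c 2 (pd c 1 h) p = pd c 1 (pd c 2 h) p"
    using p h by (rule pd_commute[rotated])
  have "dZ 1 (-1 + m) (dZ 2 m h) p - dZ 2 (1 + m) (dZ 1 m h) p = - of_int m * of_real K * h p"
    unfolding dZ_def[of 1 "-1 + m"] dZ_def[of 2 "1 + m"] D pd_Z[OF p] kappa_Zdet[OF p, symmetric]
      kappa_def Zdet_def
    by (simp add: dZ_def sum_2 c Gam_sym[OF p, of _ 2 1] algebra_simps)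
  then show ?thesis
    using exhaust_2[of b] by (auto simp: algebra_simps)
qed

text \<open>The frame component of the iterated covariant derivative at a word, as
  \<open>nabla_pow_Zw\<close> shows. The first letter is the last direction of differentiation, as
  in \<open>cov_deriv\<close>.\<close>

primrec Fw :: "('a \<Rightarrow> complex) \<Rightarrow> 2 list \<Rightarrow> 'a \<Rightarrow> complex"
  where
    "Fw h [] = h"
  | "Fw h (b # w) = dZ b (wt w) (Fw h w)"

lemma Fw_smooth: "smooth_in c W h \<Longrightarrow> smooth_in c W (Fw h w)"
  by (induction w) (auto intro: smooth_intros)

lemma nabla_pow_smooth: "smooth_in c W h \<Longrightarrow> smooth_in c W (nabla_pow g c k h I)"
proof (induction k arbitrary: I)
  case (Suc k)
  have "smooth_in c W (\<lambda>p. cov_deriv g c (nabla_pow g c k h) I p)"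
    by (cases I) (auto simp: Gam_def[symmetric] intro!: smooth_intros Suc)
  then show ?case by simp
qed simp

text \<open>Differentiate the contraction with the frame word: \<open>sum_words_updates\<close>
  moves the Christoffel terms onto the tensor, where they complete \<open>cov_deriv\<close>, and the
  weight term is the one that \<open>dZ\<close> subtracts.\<close>

lemma nabla_pow_Zw:
  assumes h: "smooth_in c W h"
  shows "p \<in> W \<Longrightarrow> (\<Sum>I | length I = length w. nabla_pow g c (length w) h I p * Zw w I p) = Fw h w p"
proof (induction w arbitrary: p)
  case Nil
  then show ?case by (simp add: Zw_def)
next
  case (Cons b w)
  define T where "T = nabla_pow g c (length w) h"
  note [smooth_intros] = nabla_pow_smooth[OF h, of "length w", folded T_def]
  have "pd c i (Fw h w) p = pd c i (\<lambda>p. \<Sum>I | length I = length w. T I p * Zw w I p) p" for i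
    using Cons T_def by (intro pd_cong) auto
  also have "\<dots> i = (\<Sum>I | length I = length w. pd c i (\<lambda>p. T I p * Zw w I p) p)" for i
    using Cons.prems by (intro pd_sum smooth_intros) auto
  also have "\<dots> i = (\<Sum>I | length I = length w. pd c i (T I) p * Zw w I p + T I p * pd c i (Zw w I) p)" for i
    using Cons.prems by (intro sum.cong refl pd_mult smooth_intros) auto
  also have "\<dots> i = (\<Sum>I | length I = length w. pd c i (T I) p * Zw w I p
      + of_int (wt w) * al i p * (T I p * Zw w I p)
      - T I p * (\<Sum>r<length I. \<Sum>m\<in>UNIV. Gam (I ! r) i m p * Zw w (I[r := m]) p))" for i
    using Cons.prems by (intro sum.cong refl) (simp add: pd_Zw algebra_simps)
  also have "\<dots> i = of_int (wt w) * al i p * Fw h w p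
      + (\<Sum>I | length I = length w. (pd c i (T I) p
        - (\<Sum>r<length I. \<Sum>m\<in>UNIV. Gam m i (I ! r) p * T (I[r := m]) p)) * Zw w I p)" for i
    unfolding Cons.IH[OF Cons.prems, symmetric] T_def[symmetric] sum_subtractf sum.distrib
      sum_words_updates[where a = "\<lambda>m j. Gam m i j p" and T = "\<lambda>I. T I p"
        and Y = "\<lambda>I. Zw w I p"] left_diff_distrib
    by (simp add: sum_distrib_left[symmetric])
  finally have "pd c i (Fw h w) p - of_int (wt w) * al i p * Fw h w p
      = (\<Sum>I | length I = length w. cov_deriv g c T (i # I) p * Zw w I p)" for i
    by (simp add: Gam_def)
  then show ?case
    by (simp add: dZ_def sum_words_Suc T_def[symmetric] Zw_def sum_distrib_left mult_ac)
qed

text \<open>The full contraction is the same in the frame as in coordinates, because the frame words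
  and coframe words are dual bases.\<close>

lemma chart_act_eq:
  assumes h: "smooth_in c W h" and p: "p \<in> W"
  shows "chart_act g c k X h p = (\<Sum>w | length w = k. Fw h w p * component X w p)"
proof -
  let ?T = "\<lambda>I. nabla_pow g c k h I p"
  have d: "(\<Sum>w | length w = k. Zw w I p * thw w J p) = (if I = J then 1 else 0)"
    if "length I = k" "length J = k" for I J
  proof -
    have "(\<Sum>w | length w = k. Zw w I p * thw w J p)
        = (\<Sum>w | length w = length I. tprod (\<lambda>i b. Z b i p) I w * thw w J p)"
      using that by (intro sum.cong) (auto simp: Zw_def intro: tprod_transpose)
    also have "\<dots> = (if I = J then 1 else 0)"
      unfolding thw_def using that by (subst tprod_compose) (simp_all add: Z_th[OF p] tprod_delta)
    finally show ?thesis .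
  qed
  have "(\<Sum>w | length w = k. Fw h w p * component X w p)
    = (\<Sum>w | length w = k. \<Sum>I | length I = k. \<Sum>J | length J = k. ?T I * X c p J * (Zw w I p * thw w J p))"
  proof (intro sum.cong refl)
    fix w :: "2 list" assume "w \<in> {w. length w = k}"
    then have w: "length w = k" by simp
    show "Fw h w p * component X w p
      = (\<Sum>I | length I = k. \<Sum>J | length J = k. ?T I * X c p J * (Zw w I p * thw w J p))"
      unfolding nabla_pow_Zw[OF h p, symmetric] component_def w sum_product
      by (simp add: mult_ac)
  qed
  also have "\<dots> = (\<Sum>I | length I = k. \<Sum>J | length J = k. \<Sum>w | length w = k. ?T I * X c p J * (Zw w I p * thw w J p))"
    by (rule trans[OF sum.swap], rule sum.cong[OF refl], rule sum.swap)
  also have "\<dots> = (\<Sum>I | length I = k. \<Sum>J | length J = k. ?T I * X c p J * (if I = J then 1 else 0))"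
    by (intro sum.cong refl) (simp add: sum_distrib_left[symmetric] d)
  also have "\<dots> = chart_act g c k X h p"
    unfolding chart_act_def by (intro sum.cong refl) (simp add: if_distrib cong: if_cong)
  finally show ?thesis by simp
qed

section \<open>Eigenfunctions: reduction to words in one letter\<close>

context
  fixes f :: "'a \<Rightarrow> complex" and lam :: complex
  assumes f: "smooth_in c W f" and eigen: "p \<in> W \<Longrightarrow> - laplacian g c f p = lam * f p"
begin

text \<open>For \<open>n = 0\<close> the commutator vanishes, so the components at 12 and 21 are
  equal, each half of the Laplacian. In the step, the first two letters are exchanged at the cost of
  (n + 1) \<open>K\<close>, which is exactly the increment of \<open>ladder\<close>.\<close>

lemma Fw_replicate:
  "p \<in> W \<Longrightarrow> Fw f (b # replicate (Suc n) (flip b)) p = ladder lam K n * Fw f (replicate n (flip b)) p"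
proof (induction n arbitrary: p)
  case 0
  have "Fw f [1, 2] p - Fw f [2, 1] p = 0"
    using dZ_commutator[OF f 0, of 1 0] by simp
  moreover have "Fw f [1, 2] p + Fw f [2, 1] p = laplacian g c f p"
    unfolding laplacian_frame[OF f 0] by (simp add: dZ_def[abs_def])
  moreover have "laplacian g c f p = - lam * f p"
    using eigen[OF 0] by (simp add: minus_equation_iff)
  ultimately have "Fw f [1, 2] p = - lam / 2 * f p" "Fw f [2, 1] p = - lam / 2 * f p"
    by (simp_all add: field_simps)
  then show ?case
    using exhaust_2[of b] by (auto simp: ladder_def)
next
  case (Suc n)
  let ?w = "replicate (Suc n) (flip b)"
  note w = Fw_smooth[OF f, of ?w]
  have sg: "sg b * (int (Suc n) * sg (flip b)) = - int (Suc n)"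
    using exhaust_2[of b] by auto
  have "dZ (flip b) (wt (b # ?w)) (Fw f (b # ?w)) p
      = dZ (flip b) (wt (b # ?w)) (\<lambda>p. ladder lam K n * Fw f (replicate n (flip b)) p) p"
    by (intro dZ_cong Suc)
  also have "\<dots> = ladder lam K n * Fw f ?w p"
    using Suc.prems by (simp add: dZ_scale Fw_smooth[OF f] algebra_simps)
  finally have 1: "dZ (flip b) (wt (b # ?w)) (Fw f (b # ?w)) p = ladder lam K n * Fw f ?w p" .
  have "dZ b (wt (flip b # ?w)) (Fw f (flip b # ?w)) p - dZ (flip b) (wt (b # ?w)) (Fw f (b # ?w)) p
      = of_nat (Suc n) * of_real K * Fw f ?w p"
    using dZ_commutator[OF w Suc.prems, of b "wt ?w"]
    unfolding wt_simps Fw.simps wt_replicate sg by (simp del: replicate_Suc)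
  then have "dZ b (wt (flip b # ?w)) (Fw f (flip b # ?w)) p
      = (ladder lam K n + of_nat (Suc n) * of_real K) * Fw f ?w p"
    unfolding 1 by (simp add: algebra_simps)
  also have "ladder lam K n + of_nat (Suc n) * of_real K = ladder lam K (Suc n)"
    by (simp add: ladder_def field_simps)
  finally show ?case
    by simp
qed

text \<open>By induction the tail may be replaced by the one-letter word of its weight. The new
  letter then either prolongs that word or cancels one of its letters through
  \<open>Fw_replicate\<close>.\<close>

lemma Fw_eq: "p \<in> W \<Longrightarrow> Fw f w p = coef lam K w * Fw f (pure (wt w)) p"
proof (induction w arbitrary: p)
  case Nil
  then show ?case by (simp add: pure_def)
next
  case (Cons b w)
  have "Fw f (b # w) p = dZ b (wt w) (\<lambda>p. coef lam K w * Fw f (pure (wt w)) p) p"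
    using Cons by (auto intro: dZ_cong)
  also have "\<dots> = coef lam K w * Fw f (b # pure (wt w)) p"
    using Cons.prems by (simp add: dZ_scale Fw_smooth[OF f])
  also have "\<dots> = coef lam K (b # w) * Fw f (pure (wt (b # w))) p"
  proof (cases "sg b * wt w \<ge> 0")
    case True
    then show ?thesis by (simp add: Cons_pure)
  next
    case False
    then show ?thesis
      using Fw_replicate[OF Cons.prems, of b "nat \<bar>wt w\<bar> - 1"] pure_eq_replicate[of b "wt w"]
      by simp
  qed
  finally show ?case .
qed

text \<open>Only words of weight zero contribute, by \<open>component_eq_0\<close>; for them
  \<open>pure 0\<close> is the empty word and \<open>Fw_eq\<close> returns a multiple of
  \<open>f\<close>.\<close>

lemma chart_act_eq_mu:
  assumes X: "\<And>J. length J = k \<Longrightarrow> smooth_in c W (\<lambda>p. X c p J)"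
      "\<And>p i J. p \<in> W \<Longrightarrow> length J = k \<Longrightarrow> cov_deriv_tensor g c i X J p = 0"
    and p: "p \<in> W" and K: "K \<noteq> 0"
  shows "chart_act g c k X f p = mu lam k X p * f p"
proof -
  have "Fw f w p * component X w p = coef lam K w * component X w p * f p" if "length w = k" for w
    using Fw_eq[OF p, of w] component_eq_0[OF X that _ p K]
    by (cases "wt w = 0") (auto simp: pure_def)
  then show ?thesis
    unfolding chart_act_eq[OF f p] mu_def sum_distrib_right by (intro sum.cong) auto
qed

end

end

subsection \<open>Change of charts\<close>

locale chart_metric_pair =
  C: chart_metric c W g K + D: chart_metric d W g K
  for c d :: "'a::topological_space chart" and W :: "'a set" and g :: "'a metric" and K :: real
begin

text \<open>A change of coordinates maps null directions to null directions, so it either preserves the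
  two null directions or exchanges them.\<close>

lemma null_frame_change:
  assumes p: "p \<in> W" and law: "g c p = transpose (jac c d p) ** g d p ** jac c d p"
  obtains t \<sigma> where "t \<noteq> 0" "\<sigma> = id \<or> \<sigma> = flip"
    "\<And>a j. (\<Sum>i\<in>UNIV. D.th a i p * of_real (jac c d p $ i $ j))
      = (\<Sum>b\<in>UNIV. (if b = \<sigma> a then t powi sg a else 0) * C.th b j p)"
proof -
  define J where "J i j = complex_of_real (jac c d p $ i $ j)" for i j
  define \<eta> where "\<eta> a j = (\<Sum>i\<in>UNIV. D.th a i p * J i j)" for a j
  define M where "M a b = (\<Sum>j\<in>UNIV. \<eta> a j * C.Z b j p)" for a b
  have "C.gg i j p = (\<Sum>b\<in>UNIV. \<Sum>a\<in>UNIV. J a i * D.gg a b p * J b j)" for i j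
    by (simp add: C.gg_def D.gg_def J_def law matrix_matrix_mult_def transpose_def sum_distrib_right)
  also have "\<dots> i j = \<eta> 1 i * \<eta> 2 j + \<eta> 2 i * \<eta> 1 j" for i j
    unfolding D.gg_eq[OF p] \<eta>_def sum_2 by (simp add: algebra_simps)
  finally have G: "C.gg i j p = \<eta> 1 i * \<eta> 2 j + \<eta> 2 i * \<eta> 1 j" for i j .
  have M: "M 1 a * M 2 b + M 2 a * M 1 b = (if a = b then 0 else 1)" for a b
  proof -
    have "M 1 a * M 2 b + M 2 a * M 1 b = (\<Sum>i\<in>UNIV. \<Sum>j\<in>UNIV. C.gg i j p * C.Z a i p * C.Z b j p)"
      unfolding G M_def sum_2 by algebra
    then show ?thesis
      by (simp only: C.Z_metric[OF p])
  qed
  have \<eta>: "\<eta> a j = (\<Sum>b\<in>UNIV. M a b * C.th b j p)" for a j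
  proof -
    have "\<eta> a j = (\<Sum>i\<in>UNIV. \<eta> a i * (if i = j then 1 else 0))"
      by (simp add: if_distrib cong: if_cong)
    also have "\<dots> = (\<Sum>b\<in>UNIV. M a b * C.th b j p)"
      unfolding C.Z_th[OF p, symmetric] M_def by (simp add: sum_2 algebra_simps)
    finally show ?thesis .
  qed
  \<comment> \<open>The matrix \<open>M\<close> of the frame change preserves the form with zero
    diagonal and off-diagonal entries 1. These equations force it to be diagonal or antidiagonal,
    with entries \<open>t\<close> and \<open>inverse t\<close>.\<close>
  have z: "M 1 1 * M 2 1 = 0" "M 1 2 * M 2 2 = 0" "M 1 1 * M 2 2 + M 2 1 * M 1 2 = 1"
    using M[of 1 1] M[of 2 2] M[of 1 2] by (simp_all add: mult.commute)
  show ?thesis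
  proof (cases "M 2 1 = 0")
    case True
    define t where "t = M 1 1"
    have 1: "t * M 2 2 = 1" using z(3) True by (simp add: t_def)
    then have "t \<noteq> 0" "M 2 2 \<noteq> 0" by auto
    moreover from this have "M 1 2 = 0" using z(2) by simp
    moreover have "M 2 2 = inverse t" using inverse_unique[OF 1] by simp
    ultimately have "\<forall>a b. M a b = (if b = id a then t powi sg a else 0)"
      unfolding forall_2 using True by (simp add: power_int_minus t_def)
    from spec[OF spec[OF this]]
    have "\<eta> a j = (\<Sum>b\<in>UNIV. (if b = id a then t powi sg a else 0) * C.th b j p)" for a j
      by (simp only: \<eta>)
    with \<open>t \<noteq> 0\<close> show ?thesis
      unfolding \<eta>_def J_def by (intro that[of t id]) simp_all
  next
    case False
    with z(1) have 0: "M 1 1 = 0" by simp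
    define t where "t = M 1 2"
    have 1: "t * M 2 1 = 1" using z(3) 0 by (simp add: t_def mult.commute)
    then have "t \<noteq> 0" by auto
    moreover from this have "M 2 2 = 0" using z(2) by (simp add: t_def)
    moreover have "M 2 1 = inverse t" using inverse_unique[OF 1] by simp
    ultimately have "\<forall>a b. M a b = (if b = flip a then t powi sg a else 0)"
      unfolding forall_2 using 0 by (simp add: power_int_minus t_def)
    from spec[OF spec[OF this]]
    have "\<eta> a j = (\<Sum>b\<in>UNIV. (if b = flip a then t powi sg a else 0) * C.th b j p)" for a j
      by (simp only: \<eta>)
    with \<open>t \<noteq> 0\<close> show ?thesis
      unfolding \<eta>_def J_def by (intro that[of t flip]) simp_all
  qed
qed

text \<open>A component changes by \<open>t\<close> to the power of its weight and possibly by
  exchanging the letters. The power is 1 for weight zero, the other components vanish, and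
  \<open>coef\<close> is invariant under the exchange.\<close>

lemma mu_chart_change:
  assumes X: "\<And>J. length J = k \<Longrightarrow> smooth_in c W (\<lambda>p. X c p J)"
      "\<And>p i J. p \<in> W \<Longrightarrow> length J = k \<Longrightarrow> cov_deriv_tensor g c i X J p = 0"
    and X_law: "\<And>J. length J = k \<Longrightarrow> X d p J = (\<Sum>I | length I = k.
         (\<Prod>r<k. of_real (jac c d p $ (J!r) $ (I!r))) * X c p I)"
    and p: "p \<in> W" and law: "g c p = transpose (jac c d p) ** g d p ** jac c d p"
    and K: "K \<noteq> 0"
  shows "D.mu lam k X p = C.mu lam k X p"
proof -
  let ?J = "\<lambda>i j. complex_of_real (jac c d p $ i $ j)"
  obtain t \<sigma> where t: "t \<noteq> 0" and \<sigma>: "\<sigma> = id \<or> \<sigma> = flip"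
    and th: "\<And>a j. (\<Sum>i\<in>UNIV. D.th a i p * ?J i j)
      = (\<Sum>b\<in>UNIV. (if b = \<sigma> a then t powi sg a else 0) * C.th b j p)"
    using null_frame_change[OF p law] by blast
  have comp: "D.component X w p = t powi wt w * C.component X (map \<sigma> w) p" if w: "length w = k" for w
  proof -
    have key: "(\<Sum>J | length J = k. D.thw w J p * tprod ?J J I) = t powi wt w * C.thw (map \<sigma> w) I p"
      if I: "length I = k" for I
    proof -
      have wI: "length w = length I" using w I by simp
      have "(\<Sum>J | length J = k. D.thw w J p * tprod ?J J I)
          = tprod (\<lambda>a j. \<Sum>i\<in>UNIV. D.th a i p * ?J i j) w I"
        unfolding D.thw_def w[symmetric] by (rule tprod_compose[OF wI])
      also have "\<dots> = (\<Sum>v | length v = length w.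
          tprod (\<lambda>a b. if b = \<sigma> a then t powi sg a else 0) w v * C.thw v I p)"
        unfolding C.thw_def th by (rule tprod_compose[OF wI, symmetric])
      also have "\<dots> = (\<Sum>v | length v = length w. if v = map \<sigma> w then t powi wt w * C.thw v I p else 0)"
        by (intro sum.cong refl) (simp add: tprod_monomial[OF t])
      finally show ?thesis by simp
    qed
    have "D.component X w p = (\<Sum>J | length J = k. \<Sum>I | length I = k.
        D.thw w J p * tprod ?J J I * X c p I)"
      unfolding D.component_def w
      by (intro sum.cong refl) (simp add: X_law tprod_def sum_distrib_left mult.assoc)
    also have "\<dots> = (\<Sum>I | length I = k. (\<Sum>J | length J = k. D.thw w J p * tprod ?J J I) * X c p I)"
      by (subst sum.swap) (simp add: sum_distrib_right)
    also have "\<dots> = t powi wt w * C.component X (map \<sigma> w) p"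
      by (simp add: key C.component_def w sum_distrib_left mult.assoc)
    finally show ?thesis .
  qed
  have \<sigma>_simps: "wt (map \<sigma> w) = 0 \<longleftrightarrow> wt w = 0" "coef lam K (map \<sigma> w) = coef lam K w"
      "map \<sigma> (map \<sigma> w) = w" for w
    using \<sigma> by (elim disjE; simp add: coef_map_flip comp_def)+
  have "D.mu lam k X p = (\<Sum>w | length w = k. coef lam K (map \<sigma> w) * C.component X (map \<sigma> w) p)"
    unfolding D.mu_def
  proof (intro sum.cong refl)
    fix w :: "2 list" assume "w \<in> {w. length w = k}"
    then have w: "length w = k" "length (map \<sigma> w) = k" by auto
    show "coef lam K w * D.component X w p = coef lam K (map \<sigma> w) * C.component X (map \<sigma> w) p"
      using C.component_eq_0[OF X w(2) _ p K] comp[OF w(1)] \<sigma>_simps by (cases "wt w = 0") auto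
  qed
  also have "\<dots> = C.mu lam k X p"
    unfolding C.mu_def
    by (rule sum.reindex_bij_witness[of _ "map \<sigma>" "map \<sigma>"]) (simp_all only: \<sigma>_simps(3) mem_Collect_eq length_map)
  finally show ?thesis .
qed

end

subsection \<open>From local to global\<close>

text \<open>In coordinates the derivative vanishes on a ball, which is convex; \<open>N\<close> is
  the preimage of that ball.\<close>

lemma (in chart_region) locally_constant:
  fixes h :: "'a \<Rightarrow> complex"
  assumes h: "smooth_in c W h" and pd: "\<And>q i. q \<in> W \<Longrightarrow> pd c i h q = 0" and p: "p \<in> W"
  obtains N where "open N" "p \<in> N" "N \<subseteq> W" "\<And>q. q \<in> N \<Longrightarrow> h q = h p"
proof -
  obtain e where e: "e > 0" "ball (coord c p) e \<subseteq> coord c ` W"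
    using open_image p openE by (metis imageI)
  have "continuous_on (cdom c) (coord c)"
    using chart by (simp add: is_chart_def homeomorphism_def)
  then have cont: "continuous_on W (coord c)"
    using W_subset by (rule continuous_on_subset)
  have D: "(h \<circ> coord_inv c has_derivative (\<lambda>v. 0)) (at x)" if x: "x \<in> coord c ` W" for x
  proof -
    obtain q where q: "q \<in> W" "x = coord c q" using x by blast
    let ?D = "frechet_derivative (h \<circ> coord_inv c) (at x)"
    have D: "(h \<circ> coord_inv c has_derivative ?D) (at x)"
      using smooth_in_has_derivative[OF h q(1)] q(2) by simp
    have a: "?D (axis i 1) = 0" for i
      using pd[OF q(1), of i] by (simp add: pd_def partial_def q(2))
    have "?D v = 0" for v
    proof -
      have v: "(\<Sum>i\<in>UNIV. v $ i *\<^sub>R axis i 1) = v"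
        by (simp add: vec_eq_iff axis_def if_distrib cong: if_cong)
      have "?D (\<Sum>i\<in>UNIV. v $ i *\<^sub>R axis i 1) = 0"
        by (simp add: linear_sum[OF has_derivative_linear[OF D]]
            linear_cmul[OF has_derivative_linear[OF D]] a)
      then show ?thesis
        unfolding v .
    qed
    then have "?D = (\<lambda>v. 0)" by blast
    with D show ?thesis by simp
  qed
  show ?thesis
  proof (rule that)
    show "open (W \<inter> coord c -` ball (coord c p) e)"
      using continuous_open_preimage[OF cont open_W] by simp
    fix q assume q: "q \<in> W \<inter> coord c -` ball (coord c p) e"
    have "(h \<circ> coord_inv c has_derivative (\<lambda>v. 0)) (at x within ball (coord c p) e)"
      if "x \<in> ball (coord c p) e" for x
      using D[of x] e(2) that has_derivative_at_withinI by blast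
    from has_derivative_zero_unique[OF convex_ball this, of "coord c q" "coord c p"]
    have "(h \<circ> coord_inv c) (coord c q) = (h \<circ> coord_inv c) (coord c p)"
      using q e(1) by simp
    then show "h q = h p"
      using q p by simp
  qed (use p e in auto)
qed

section \<open>Global constancy of the factor\<close>

context
  fixes A :: "'a::topological_space chart set"
  assumes atlas: "smooth_atlas A"
begin

lemma is_chart_atlas: "c \<in> A \<Longrightarrow> is_chart c"
  using atlas unfolding smooth_atlas_def by blast

lemma chart_region_atlas:
  "c \<in> A \<Longrightarrow> open W \<Longrightarrow> W \<subseteq> cdom c \<Longrightarrow> chart_region c W"
  by (intro chart_region.intro is_chart_atlas)

lemma open_cdom: "c \<in> A \<Longrightarrow> open (cdom c)"
  using is_chart_atlas[of c] unfolding is_chart_def by blast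

lemma chart_at:
  shows "chart_at A p \<in> A" "p \<in> cdom (chart_at A p)"
proof -
  have "\<exists>c. c \<in> A \<and> p \<in> cdom c"
    using atlas unfolding smooth_atlas_def by blast
  then show "chart_at A p \<in> A" "p \<in> cdom (chart_at A p)"
    unfolding chart_at_def by (metis (mono_tags, lifting) someI_ex)+
qed

text \<open>The scalar \<open>a\<close> as an element of degree zero of the parallel algebra, so
  that every multiple of \<open>f\<close> is an image. Its values off the chart domains follow the
  convention of \<open>tensor_section\<close>.\<close>

definition const_tensor :: "complex \<Rightarrow> nat \<Rightarrow> 'a tensor"
  where "const_tensor a k c p J = (if c \<in> A \<and> p \<in> cdom c \<and> J = [] \<and> k = 0 then a else 0)"

lemma const_tensor_parallel: "const_tensor a \<in> parallel_algebra A g"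
proof -
  have const: "const_tensor a k c p J = (if J = [] \<and> k = 0 then a else 0)"
    if "c \<in> A" "p \<in> cdom c" for k c p J
    using that by (simp add: const_tensor_def)
  have "const_tensor a k \<in> parallel_tensors A g k" for k
    unfolding parallel_tensors_def tensor_section_def
  proof (intro CollectI conjI ballI allI impI)
    fix c p J assume "const_tensor a k c p J \<noteq> 0"
    then show "c \<in> A" "p \<in> cdom c" "length J = k"
      by (auto simp: const_tensor_def split: if_splits)
  next
    fix c J assume c: "c \<in> A"
    show "smooth_fun_on A (cdom c) (\<lambda>p. const_tensor a k c p J)"
      unfolding smooth_fun_on_def
    proof
      fix d assume d: "d \<in> A"
      interpret chart_region d "cdom c \<inter> cdom d"
        using c d by (intro chart_region_atlas open_Int open_cdom) simp_all
      have "smooth_in d (cdom c \<inter> cdom d) (\<lambda>p. const_tensor a k c p J)"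
        using c by (subst smooth_in_cong[OF const]) (auto intro: smooth_in_const)
      then show "Cinf_on (coord d ` (cdom c \<inter> cdom d)) ((\<lambda>p. const_tensor a k c p J) \<circ> coord_inv d)"
        unfolding smooth_in_def .
    qed
  next
    fix c d p and J :: "2 list" assume "c \<in> A" "d \<in> A" "p \<in> cdom c \<inter> cdom d" "length J = k"
    then show "const_tensor a k d p J = (\<Sum>I | length I = k.
        (\<Prod>r<k. of_real (jac c d p $ (J!r) $ (I!r))) * const_tensor a k c p I)"
      by (cases k) (auto simp: const_tensor_def intro!: sum.neutral[symmetric])
  next
    fix c p i and J :: "2 list" assume c: "c \<in> A" "p \<in> cdom c" and J: "length J = k"
    interpret chart_region c "cdom c"
      using c open_cdom by (intro chart_region_atlas) auto
    have "pd c i (\<lambda>q. const_tensor a k c q J) p = 0"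
      using c by (subst pd_cong[OF _ const]) auto
    then show "cov_deriv_tensor g c i (const_tensor a k) J p = 0"
      using J by (cases k) (auto simp: cov_deriv_tensor_def const_tensor_def intro!: sum.neutral)
  qed
  moreover have "finite {k. const_tensor a k \<noteq> (\<lambda>c p J. 0)}"
    by (rule finite_subset[of _ "{0}"]) (auto simp: const_tensor_def fun_eq_iff split: if_splits)
  ultimately show ?thesis
    by (simp add: parallel_algebra_def)
qed

lemma act_const_tensor: "act A g (const_tensor a) f p = a * f p"
proof -
  have "act A g (const_tensor a) f p = (\<Sum>k\<in>{0}. chart_act g (chart_at A p) k (const_tensor a k) f p)"
    unfolding act_def
  \<comment> \<open>For \<open>a = 0\<close> the index set of the sum is empty, so only its
    inclusion in \<open>{0}\<close> is available.\<close>
  proof (rule sum.mono_neutral_left)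
    show "{k. const_tensor a k \<noteq> (\<lambda>c p J. 0)} \<subseteq> {0}"
      by (auto simp: const_tensor_def fun_eq_iff)
  qed (auto simp: chart_act_def)
  then show ?thesis
    using chart_at[of p] by (simp add: chart_act_def const_tensor_def)
qed

context
  fixes g :: "'a metric" and K :: real
  assumes metric: "riemannian_metric A g" and curv: "constant_sectional_curvature A g K"
    and K: "K \<noteq> 0"
begin

lemma chart_metric_atlas:
  assumes c: "c \<in> A" and W: "open W" "W \<subseteq> cdom c"
  shows "chart_metric c W g K"
proof -
  interpret chart_region c W
    by (rule chart_region_atlas[OF assms])
  have "smooth_in c (cdom c) (g c)"
    using metric c unfolding riemannian_metric_def smooth_fun_on_def smooth_in_def by fastforce
  then have "smooth_in c W (g c)"
    using W(2) by (rule smooth_in_subset)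
  moreover have "transpose (g c p) = g c p" "v \<noteq> 0 \<Longrightarrow> v \<bullet> (g c p *v v) > 0" if "p \<in> W" for p v
    using metric c that W(2) unfolding riemannian_metric_def by blast+
  moreover have "sectional_curvature g c p u v = K" if "p \<in> W" "u \<noteq> v" "independent {u, v}" for p u v
    using curv c that W(2) unfolding constant_sectional_curvature_def by blast
  ultimately show ?thesis
    by unfold_locales
qed

lemma parallel_tensor_chart:
  assumes X: "X \<in> parallel_tensors A g k" and c: "c \<in> A" and W: "W \<subseteq> cdom c"
  shows "length J = k \<Longrightarrow> smooth_in c W (\<lambda>p. X c p J)"
    and "p \<in> W \<Longrightarrow> length J = k \<Longrightarrow> cov_deriv_tensor g c i X J p = 0"
proof -
  assume "length J = k"
  then have "smooth_fun_on A (cdom c) (\<lambda>p. X c p J)"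
    using X c by (simp add: parallel_tensors_def tensor_section_def)
  then have "smooth_in c (cdom c) (\<lambda>p. X c p J)"
    using c unfolding smooth_fun_on_def smooth_in_def by fastforce
  then show "smooth_in c W (\<lambda>p. X c p J)"
    using W by (rule smooth_in_subset)
next
  assume "p \<in> W" "length J = k"
  then show "cov_deriv_tensor g c i X J p = 0"
    using X c W by (auto simp: parallel_tensors_def)
qed

text \<open>The local factors agree on overlaps by \<open>mu_chart_change\<close>, so they define
  one function on the manifold; it is locally constant by \<open>pd_mu\<close>, hence constant by
  connectedness.\<close>

lemma mu_global:
  assumes X: "X \<in> parallel_tensors A g k" and conn: "connected (UNIV :: 'a set)"
  obtains m where "\<And>c p. c \<in> A \<Longrightarrow> p \<in> cdom c \<Longrightarrow> chart_metric.mu c g K lam k X p = m"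
proof -
  let ?mu = "\<lambda>c p. chart_metric.mu c g K lam k X p"
  have indep: "?mu d p = ?mu c p" if "c \<in> A" "d \<in> A" "p \<in> cdom c" "p \<in> cdom d" for c d p
  proof -
    let ?W = "cdom c \<inter> cdom d"
    have p: "p \<in> ?W" using that by simp
    interpret chart_metric_pair c d ?W g K
      using that by (intro chart_metric_pair.intro chart_metric_atlas open_Int open_cdom) simp_all
    show ?thesis
    proof (rule mu_chart_change[OF parallel_tensor_chart[OF X that(1)] _ p _ K])
      show "X d p J = (\<Sum>I | length I = k. (\<Prod>r<k. of_real (jac c d p $ (J!r) $ (I!r))) * X c p I)"
        if "length J = k" for J
        using X p \<open>c \<in> A\<close> \<open>d \<in> A\<close> that unfolding parallel_tensors_def tensor_section_def by blast
      show "g c p = transpose (jac c d p) ** g d p ** jac c d p"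
        using metric p that unfolding riemannian_metric_def by blast
    qed auto
  qed
  let ?m = "\<lambda>p. ?mu (chart_at A p) p"
  have "?m constant_on UNIV"
  proof (rule locally_constant_imp_constant[OF conn])
    fix p :: 'a
    let ?c = "chart_at A p"
    interpret chart_metric ?c "cdom ?c" g K
      using chart_at open_cdom by (intro chart_metric_atlas) auto
    note X' = parallel_tensor_chart[OF X chart_at(1) order_refl]
    obtain N where N: "open N" "p \<in> N" "N \<subseteq> cdom ?c" "\<And>q. q \<in> N \<Longrightarrow> mu lam k X q = mu lam k X p"
      using locally_constant[OF mu_smooth[OF X'] pd_mu[OF X' _ K] chart_at(2)] by blast
    then have const: "\<forall>q\<in>N. ?m q = ?m p"
      using indep[OF _ chart_at(1) _ chart_at(2)] chart_at by (metis subsetD)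
    have "openin (top_of_set UNIV) N"
      using N(1) by simp
    with N(2) const show "\<exists>T. openin (top_of_set UNIV) T \<and> p \<in> T \<and> (\<forall>x\<in>T. ?m x = ?m p)"
      by blast
  qed
  then obtain m where m: "\<And>p. ?m p = m"
    unfolding constant_on_def by blast
  show ?thesis
  proof (rule that)
    fix c p assume "c \<in> A" "p \<in> cdom c"
    then show "?mu c p = m"
      using indep[OF chart_at(1) _ chart_at(2)] m by simp
  qed
qed

text \<open>The constant of each degree comes from the whole manifold, so one scalar serves all of
  \<open>U\<close> even if \<open>U\<close> is disconnected. Adding over the degrees gives
  \<open>a\<close>.\<close>

lemma act_eigenfunction:
  assumes conn: "connected (UNIV :: 'a set)" and "open U" "smooth_fun_on A U f"
    and eigen: "\<forall>c\<in>A. \<forall>p\<in>U \<inter> cdom c. - laplacian g c f p = lam * f p"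
    and X: "X \<in> parallel_algebra A g"
  obtains a where "\<And>p. p \<in> U \<Longrightarrow> act A g X f p = a * f p"
proof -
  have Xk: "X k \<in> parallel_tensors A g k" for k
    using X by (simp add: parallel_algebra_def)
  have "\<exists>m. \<forall>p\<in>U. chart_act g (chart_at A p) k (X k) f p = m * f p" for k
  proof -
    obtain m where m: "\<And>c p. c \<in> A \<Longrightarrow> p \<in> cdom c \<Longrightarrow> chart_metric.mu c g K lam k (X k) p = m"
      using mu_global[OF Xk[of k] conn, where lam = lam] by blast
    have "chart_act g c k (X k) f p = m * f p" if c: "c \<in> A" "p \<in> U \<inter> cdom c" for c p
    proof -
      interpret chart_metric c "U \<inter> cdom c" g K
        using c assms(2) by (intro chart_metric_atlas open_Int open_cdom) simp_all
      have f: "smooth_in c (U \<inter> cdom c) f"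
        using assms(3) c unfolding smooth_fun_on_def smooth_in_def by blast
      have "chart_act g c k (X k) f p = mu lam k (X k) p * f p"
      proof (rule chart_act_eq_mu[OF f _ parallel_tensor_chart[OF Xk[of k] c(1) Int_lower2] c(2) K])
        show "- laplacian g c f q = lam * f q" if "q \<in> U \<inter> cdom c" for q
          using eigen c(1) that by blast
      qed
      also have "mu lam k (X k) p = m"
        using c by (intro m) simp_all
      finally show ?thesis .
    qed
    then show ?thesis
      using chart_at by blast
  qed
  then obtain m where "\<And>k p. p \<in> U \<Longrightarrow> chart_act g (chart_at A p) k (X k) f p = m k * f p"
    by metis
  then show ?thesis
    by (intro that[of "\<Sum>k | X k \<noteq> (\<lambda>c p J. 0). m k"]) (simp add: act_def sum_distrib_right)
qed

end

end

theorem theorem4p5: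
  fixes A :: "'a::{t2_space, second_countable_topology} chart set"
    and g :: "'a metric"
    and K :: real
    and U :: "'a set"
    and f :: "'a \<Rightarrow> complex"
    and lam :: complex
  assumes "smooth_atlas A"
    and "riemannian_metric A g"
    and "connected (UNIV :: 'a set)"
    and "geodesically_complete A g"
    and "orientable A"
    and "constant_sectional_curvature A g K"
    and "K \<noteq> 0"
    and "open U"
    and "smooth_fun_on A U f"
    and "\<forall>c\<in>A. \<forall>p\<in>U \<inter> cdom c. - laplacian g c f p = lam * f p"
  shows "parallel_images A g U f = {(\<lambda>p\<in>U. a * f p) | a. True}"
proof (intro subset_antisym subsetI)
  fix h assume "h \<in> parallel_images A g U f"
  then obtain X where X: "X \<in> parallel_algebra A g" "h = restrict (act A g X f) U"
    by (auto simp: parallel_images_def)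
  obtain a where "\<And>p. p \<in> U \<Longrightarrow> act A g X f p = a * f p"
    using act_eigenfunction[OF assms(1,2,6,7,3,8,9,10) X(1)] by blast
  then have "h = (\<lambda>p\<in>U. a * f p)"
    unfolding X(2) by (rule restrict_ext)
  then show "h \<in> {(\<lambda>p\<in>U. a * f p) | a. True}"
    by blast
next
  fix h assume "h \<in> {(\<lambda>p\<in>U. a * f p) | a. True}"
  then obtain a where "h = (\<lambda>p\<in>U. a * f p)"
    by blast
  then have "h = restrict (act A g (const_tensor A a) f) U"
    by (simp add: fun_eq_iff restrict_def act_const_tensor[OF assms(1)])
  then show "h \<in> parallel_images A g U f"
    using const_tensor_parallel[OF assms(1)] unfolding parallel_images_def by blast
qed

end
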